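(* There exists a sequence of real numbers $\eta(n)$ with $\eta(n)\to 0$ as $n\to\infty$ such that for every $\varepsilon>0$ there exists $n_0$ for which the following holds for all $n\ge n_0$ and $d\ge 2$. Let $0<\rho\le n^{-n}$ and $N>1$ satisfy $\log(N\rho)>(3/2+\varepsilon)\,n\log n$. Consider an evolution, on the time interval $(-\infty,\infty)$, of $n$ hard balls $B_1,\dots,B_n$ in $\mathbb{R}^d$ of equal masses and radii $1$, colliding elastically, with no simultaneous collisions. If the total number of collisions is greater than or equal to $N$, then there exist a family $\mathcal{B}=\{B_{i_1},\dots,B_{i_k}\}$ of balls and an interval $[t_1,t_2]$ such that $\mathcal{B}$ is $\rho$-connected in $[t_1,t_2]$ and there are more than $N\rho\, n^{-(3/2+\eta(n))n}$ collisions among balls in $\mathcal{B}$ on $[t_1,t_2]$.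
   Context: Hard ball dynamics: $n$ balls in $\mathbb{R}^d$ have radius $1$ and equal masses. The centers $x^k(t)$ are continuous functions of $t\in\mathbb{R}$ with $|x^j(t)-x^k(t)|\ge 2$ for $j\ne k$ (balls do not overlap), and velocities $v^k$ are constant between collisions. Balls $j$ and $k$ collide at time $t$ if $|x^j(t)-x^k(t)|=2$ and their velocities change at time $t$. In that case the velocities just before the collision satisfy $(v^j(t-)-v^k(t-))\cdot(x^j(t)-x^k(t))<0$ and, with $x^{jk}(t)=(x^j(t)-x^k(t))/|x^j(t)-x^k(t)|$, $$v^j(t+)=v^j(t-)+(v^k(t-)\cdot x^{jk}(t))x^{jk}(t)-(v^j(t-)\cdot x^{jk}(t))x^{jk}(t),$$ $$v^k(t+)=v^k(t-)+(v^j(t-)\cdot x^{jk}(t))x^{jk}(t)-(v^k(t-)\cdot x^{jk}(t))x^{jk}(t).$$ The velocity of a ball changes only at its collisions. No simultaneous collisions: there is no time $t$ and no collection of at least three balls such that any two balls of the collection are linked by a chain of balls in which consecutive balls are in contact at time $t$. (Two disjoint touching pairs at the same time are allowed.) Consequently there are only finitely many collisions in every finite time interval. $\rho$-connectedness: for $\rho>0$, $\Gamma_\rho(t)$ is the graph with vertices $B_1,\dots,B_n$ in which $B_j$ and $B_k$ are joined by an edge if and only if $|x^j(t)-x^k(t)|\le 2+\rho$. A subfamily $\{B_{i_1},\dots,B_{i_k}\}$ is $\rho$-connected in $[s,u]$ if for every $t\in[s,u]$ all the balls $B_{i_1},\dots,B_{i_k}$ belong to one connected component of $\Gamma_\rho(t)$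 (the component may depend on $t$ and may contain other balls). A collision among balls in $\mathcal{B}$ is a collision between two balls both belonging to $\mathcal{B}$. $\log$ is the natural logarithm. *)

theory Defs
  imports "HOL-Analysis.Analysis"
begin

text \<open>
  The dimension \<open>d\<close> is quantified inside the theorem, so it cannot be a type parameter.
  Vectors of \<open>d\<close>-dimensional space are points of the library space
  \<^term>\<open>Euclidean_space d\<close>, that is, functions \<open>nat \<Rightarrow> real\<close> vanishing at all
  indices \<open>i \<ge> d\<close>; the Euclidean norm of \<open>u\<close> is \<open>L2_set u {..<d}\<close>.
\<close>

type_synonym trajectories = "nat \<Rightarrow> real \<Rightarrow> nat \<Rightarrow> real"
  \<comment> \<open>\<open>x k t i\<close>: coordinate \<open>i\<close> at time \<open>t\<close> of the center of ball \<open>k\<close>;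
     the \<open>n\<close> balls are numbered \<open>0, ..., n - 1\<close>\<close>

definition inner_prod :: "nat \<Rightarrow> (nat \<Rightarrow> real) \<Rightarrow> (nat \<Rightarrow> real) \<Rightarrow> real" where
  "inner_prod d u v = (\<Sum>i<d. u i * v i)"

definition center_dist :: "nat \<Rightarrow> trajectories \<Rightarrow> real \<Rightarrow> nat \<Rightarrow> nat \<Rightarrow> real" where
  "center_dist d x t j k = L2_set (\<lambda>i. x j t i - x k t i) {..<d}"

definition center_dir :: "nat \<Rightarrow> trajectories \<Rightarrow> real \<Rightarrow> nat \<Rightarrow> nat \<Rightarrow> nat \<Rightarrow> real" where
  "center_dir d x t j k = (\<lambda>i. (x j t i - x k t i) / center_dist d x t j k)"

text \<open>
  The velocities \<open>v(t-)\<close> and \<open>v(t+)\<close> are the left and right derivatives of the position;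
  the locale below requires both to exist at all times.
\<close>

definition vel_before :: "trajectories \<Rightarrow> nat \<Rightarrow> real \<Rightarrow> nat \<Rightarrow> real" where
  "vel_before x k t = (\<lambda>i. vector_derivative (\<lambda>s. x k s i) (at_left t))"

definition vel_after :: "trajectories \<Rightarrow> nat \<Rightarrow> real \<Rightarrow> nat \<Rightarrow> real" where
  "vel_after x k t = (\<lambda>i. vector_derivative (\<lambda>s. x k s i) (at_right t))"

definition collide :: "nat \<Rightarrow> nat \<Rightarrow> trajectories \<Rightarrow> real \<Rightarrow> nat \<Rightarrow> nat \<Rightarrow> bool" where
  "collide n d x t j k \<longleftrightarrow>
     j < n \<and> k < n \<and> j \<noteq> k \<and> center_dist d x t j k = 2 \<and>
     vel_before x j t \<noteq> vel_after x j t \<and> vel_before x k t \<noteq> vel_after x k t"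

text \<open>
  The pairs of distinct balls whose surfaces are at distance at most \<open>r\<close> at time \<open>t\<close>:
  the edges of \<open>\<Gamma>\<^sub>r(t)\<close> for \<open>r > 0\<close>, and the touching pairs for \<open>r = 0\<close>, since balls do
  not overlap. Two balls are linked by a chain, i.e. belong to one connected component, when
  they are related by the reflexive transitive closure of this symmetric relation.
\<close>

definition near :: "nat \<Rightarrow> nat \<Rightarrow> trajectories \<Rightarrow> real \<Rightarrow> real \<Rightarrow> (nat \<times> nat) set" where
  "near n d x r t = {(j, k). j < n \<and> k < n \<and> j \<noteq> k \<and> center_dist d x t j k \<le> 2 + r}"

locale hard_ball_evolution =
  fixes n d :: nat and x :: trajectories
  assumes continuous:
      "\<And>k. k < n \<Longrightarrow> continuous_map euclideanreal (Euclidean_space d) (x k)"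
    and no_overlap:
      "\<And>t j k. j < n \<Longrightarrow> k < n \<Longrightarrow> j \<noteq> k \<Longrightarrow> 2 \<le> center_dist d x t j k"
    and velocity_left_exists:
      "\<And>k t i. k < n \<Longrightarrow> (\<lambda>s. x k s i) differentiable (at_left t)"
    and velocity_right_exists:
      "\<And>k t i. k < n \<Longrightarrow> (\<lambda>s. x k s i) differentiable (at_right t)"
    and velocity_changes_only_at_collisions:
      "\<And>k t. k < n \<Longrightarrow> vel_before x k t \<noteq> vel_after x k t \<Longrightarrow> \<exists>j. collide n d x t j k"
    and velocity_constant_between_collisions:
      "\<And>k s u. k < n \<Longrightarrow> s < u \<Longrightarrow> (\<And>t j. s < t \<Longrightarrow> t < u \<Longrightarrow> \<not> collide n d x t j k) \<Longrightarrow>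
         \<exists>w. \<forall>t\<in>{s<..<u}. vel_before x k t = w \<and> vel_after x k t = w"
    and approaching:
      "\<And>t j k. collide n d x t j k \<Longrightarrow>
         inner_prod d (\<lambda>i. vel_before x j t i - vel_before x k t i) (\<lambda>i. x j t i - x k t i) < 0"
    \<comment> \<open>\<^const>\<open>collide\<close> is symmetric, so this also gives the law for the second ball\<close>
    and elastic:
      "\<And>t j k i. collide n d x t j k \<Longrightarrow>
         vel_after x j t i = vel_before x j t i
           + inner_prod d (vel_before x k t) (center_dir d x t j k) * center_dir d x t j k i
           - inner_prod d (vel_before x j t) (center_dir d x t j k) * center_dir d x t j k i"
    and no_simultaneous_collisions:
      "\<nexists>t S. S \<subseteq> {..<n} \<and> 3 \<le> card S \<and> S \<times> S \<subseteq> (near n d x 0 t)\<^sup>*"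

text \<open>
  A collision is recorded as an unordered pair of balls together with its time.  Its number is
  taken in \<^typ>\<open>ennreal\<close>, so that an infinite set of collisions counts as \<open>\<infinity>\<close>.
\<close>

definition collisions ::
  "nat \<Rightarrow> nat \<Rightarrow> trajectories \<Rightarrow> nat set \<Rightarrow> real set \<Rightarrow> (nat set \<times> real) set" where
  "collisions n d x B T = {({j, k}, t) |j k t. j \<in> B \<and> k \<in> B \<and> t \<in> T \<and> collide n d x t j k}"

definition num_collisions ::
  "nat \<Rightarrow> nat \<Rightarrow> trajectories \<Rightarrow> nat set \<Rightarrow> real set \<Rightarrow> ennreal" where
  "num_collisions n d x B T = emeasure (count_space UNIV) (collisions n d x B T)"

definition rho_connected ::
  "nat \<Rightarrow> nat \<Rightarrow> trajectories \<Rightarrow> real \<Rightarrow> nat set \<Rightarrow> real \<Rightarrow> real \<Rightarrow> bool" where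
  "rho_connected n d x \<rho> B s u \<longleftrightarrow> (\<forall>t\<in>{s..u}. B \<times> B \<subseteq> (near n d x \<rho> t)\<^sup>*)"

end

theory Submission
  imports Defs
begin

text \<open>
  Consider a family of \<open>m\<close> balls that collide only among themselves, as a path \<open>w\<close> in configuration
  space with the center of mass at the origin. Put \<open>R = |w|\<close>. The speed \<open>V\<close> of \<open>w\<close> is constant, and
  each collision increases \<open>w \<cdot> w'\<close>. Hence the angle \<open>\<theta>\<close> between \<open>w\<close> and \<open>w'\<close> never
  increases, the direction \<open>w / R\<close> turns by at most the decrease of \<open>\<theta>\<close>, so by at most \<open>\<pi>\<close> over all
  times, and the times with \<open>R \<le> L\<close> form an interval of length at most \<open>2 L / V\<close>.

  Let \<open>M\<close> bound the number of collisions inside \<open>\<rho>\<close>-connected families and take \<open>L = 4 m\<^sup>3\<^sup>/\<^sup>2\<close>. The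
  times with \<open>R \<le> L\<close> are cut into \<open>O(m\<^sup>3\<^sup>/\<^sup>2 / \<rho>)\<close> pieces during which the balls hardly move; in each
  piece the collisions occur inside at most \<open>m\<close> \<open>\<rho>\<close>-connected subfamilies. The times with \<open>R > L\<close> are
  cut into \<open>O(m\<^sup>3\<^sup>/\<^sup>2)\<close> pieces on which \<open>\<theta>\<close> varies by less than \<open>m\<^sup>-\<^sup>3\<^sup>/\<^sup>2 / 8\<close>. A family with large \<open>R\<close>
  has two parts separated by a gap of order \<open>R / m\<^sup>3\<^sup>/\<^sup>2\<close>, which such a small turn cannot close, so the
  parts evolve independently during the piece. By induction on \<open>m\<close>, all \<open>n\<close> balls together have at most
  \<open>C\<^sup>n n\<^sup>3\<^sup>n\<^sup>/\<^sup>2\<^sup>+\<^sup>1 M / \<rho>\<close> collisions.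
\<close>

section \<open>Piecewise linear paths with increasing virial\<close>

definition ip :: "'p set \<Rightarrow> ('p \<Rightarrow> real) \<Rightarrow> ('p \<Rightarrow> real) \<Rightarrow> real" where
  "ip P f g = (\<Sum>p\<in>P. f p * g p)"

lemma ip_commute: "ip P f g = ip P g f"
  by (simp add: ip_def mult.commute)

lemma ip_add_scaled_left: "ip P (\<lambda>p. f p + c * g p) h = ip P f h + c * ip P g h"
  by (simp add: ip_def algebra_simps sum.distrib sum_distrib_left)

lemma ip_cong: "(\<And>p. p \<in> P \<Longrightarrow> f p = f' p) \<Longrightarrow> (\<And>p. p \<in> P \<Longrightarrow> g p = g' p) \<Longrightarrow> ip P f g = ip P f' g'"
  by (simp add: ip_def)

lemma ip_self_nonneg: "0 \<le> ip P f f"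
  by (simp add: ip_def sum_nonneg)

lemma L2_set_conv_ip: "L2_set f P = sqrt (ip P f f)"
  by (simp add: L2_set_def ip_def power2_eq_square)

lemma abs_ip_le: "\<bar>ip P f g\<bar> \<le> L2_set f P * L2_set g P"
proof -
  have "\<bar>ip P f g\<bar> \<le> (\<Sum>p\<in>P. \<bar>f p\<bar> * \<bar>g p\<bar>)"
    unfolding ip_def by (rule order_trans[OF sum_abs]) (simp add: abs_mult)
  then show ?thesis using L2_set_mult_ineq[of f g P] by linarith
qed

lemma L2_set_triangle_ineq_diff: "L2_set f P - L2_set g P \<le> L2_set (\<lambda>p. f p - g p) P"
  using L2_set_triangle_ineq[of "\<lambda>p. f p - g p" g P] by simp

lemma L2_set_minus_commute: "L2_set (\<lambda>p. f p - g p) P = L2_set (\<lambda>p. g p - f p) P"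
  by (simp add: L2_set_def power2_commute)

lemma abs_quot_le_1: "\<bar>g\<bar> \<le> b \<Longrightarrow> \<bar>g / b\<bar> \<le> (1::real)"
  by (cases "b = 0") (auto simp: divide_le_eq_1)

text \<open>The left-hand side is the squared chord of the angle \<open>x\<close> on the unit
  circle, and a chord is at most its arc.\<close>

lemma two_minus_two_cos_le: "2 - 2 * cos (x::real) \<le> x\<^sup>2"
proof -
  have "cos x = 1 - 2 * (sin (x/2))\<^sup>2" using cos_double_sin[of "x/2"] by simp
  moreover have "(sin (x/2))\<^sup>2 \<le> (x/2)\<^sup>2"
    using abs_sin_x_le_abs_x[of "x/2"] by (simp only: abs_le_square_iff)
  ultimately show ?thesis by (simp add: power2_eq_square)
qed

text \<open>Such a quotient will be the cosine of the angle between position and velocity. For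
  nonnegative numbers squares are compared; two negative numbers are reduced to this case by
  changing signs, and mixed signs are immediate.\<close>

lemma div_sqrt_mono:
  assumes "a \<le> b" "0 \<le> D" "0 < a\<^sup>2 + D" "0 < b\<^sup>2 + D"
  shows "a / sqrt (a\<^sup>2 + D) \<le> b / sqrt (b\<^sup>2 + (D::real))"
proof -
  have pos: "0 < sqrt (a\<^sup>2 + D)" "0 < sqrt (b\<^sup>2 + D)" using assms by simp_all
  have key: "y * sqrt (x\<^sup>2 + D) \<ge> x * sqrt (y\<^sup>2 + D)" if "0 \<le> x" "x \<le> y" for x y
  proof -
    have "x * sqrt (y\<^sup>2 + D) = sqrt (x\<^sup>2 * (y\<^sup>2 + D))" using that by (simp add: real_sqrt_mult)
    also have "\<dots> \<le> sqrt (y\<^sup>2 * (x\<^sup>2 + D))"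
      using that assms(2) mult_right_mono[of "x\<^sup>2" "y\<^sup>2" D] by (simp add: algebra_simps power_mono)
    also have "\<dots> = y * sqrt (x\<^sup>2 + D)" using that by (simp add: real_sqrt_mult)
    finally show ?thesis .
  qed
  have "a * sqrt (b\<^sup>2 + D) \<le> b * sqrt (a\<^sup>2 + D)"
  proof (cases "0 \<le> a")
    case True then show ?thesis using key assms by auto
  next
    case False
    show ?thesis
    proof (cases "b \<ge> 0")
      case True
      have "a * sqrt (b\<^sup>2 + D) \<le> 0" using False pos by (simp add: mult_nonpos_nonneg)
      also have "\<dots> \<le> b * sqrt (a\<^sup>2 + D)" using True pos by simp
      finally show ?thesis .
    next
      case False
      then show ?thesis using key[of "-b" "-a"] assms by auto
    qed
  qed
  then show ?thesis using pos by (simp add: field_simps)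
qed

text \<open>
  Seen from the origin, a point moving along a ray turns by exactly \<open>\<theta> - \<theta>'\<close>, by the exterior
  angle theorem; the left-hand side is the chord of that angle.
\<close>

lemma angle_along_ray:
  fixes P :: "'p set" and w v :: "'p \<Rightarrow> real" and h :: real
  defines "A \<equiv> ip P w v" and "E \<equiv> ip P v v"
  defines "w' \<equiv> (\<lambda>p. w p + h * v p)"
  assumes h: "0 \<le> h" and E: "0 < E" and pos: "0 < L2_set w P" "0 < L2_set w' P"
  defines "\<theta> \<equiv> arccos (A / (L2_set w P * sqrt E))"
    and "\<theta>' \<equiv> arccos (ip P w' v / (L2_set w' P * sqrt E))"
  shows "L2_set (\<lambda>p. w' p / L2_set w' P - w p / L2_set w P) P \<le> \<theta> - \<theta>'"
proof -
  define R1 R2 where "R1 = L2_set w P" and "R2 = L2_set w' P"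
  define A2 where "A2 = ip P w' v"
  \<comment> \<open>\<open>D\<close> is the Gram determinant of position and velocity. It does not
    change along the ray, so both cosines have the form \<open>a / sqrt (a\<^sup>2 + D)\<close> with
    the same \<open>D\<close>, and only \<open>a\<close> changes.\<close>
  define D where "D = R1\<^sup>2 * E - A\<^sup>2"
  have R1: "R1\<^sup>2 = ip P w w" and R2': "R2\<^sup>2 = ip P w' w'"
    by (simp_all add: R1_def R2_def L2_set_conv_ip ip_self_nonneg)
  have A2: "A2 = A + h * E" by (simp add: A2_def w'_def ip_add_scaled_left A_def E_def)
  have ww': "ip P w w' = R1\<^sup>2 + h * A"
    unfolding w'_def by (subst ip_commute) (simp add: ip_add_scaled_left R1 A_def ip_commute)
  have vw': "ip P v w' = A + h * E" using A2 A2_def ip_commute by metis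
  have R2: "R2\<^sup>2 = R1\<^sup>2 + 2 * h * A + h\<^sup>2 * E"
  proof -
    have "ip P w' w' = ip P w w' + h * ip P v w'"
      by (subst (1) w'_def) (simp add: ip_add_scaled_left)
    then show ?thesis using ww' vw' R2' by (simp add: algebra_simps power2_eq_square)
  qed
  have D2: "D = R2\<^sup>2 * E - A2\<^sup>2"
    unfolding D_def R2 A2 by (simp add: algebra_simps power2_eq_square)
  have E': "sqrt E = L2_set v P" by (simp add: E_def L2_set_conv_ip)
  have D0: "0 \<le> D"
  proof -
    have "\<bar>A\<bar> \<le> R1 * sqrt E" unfolding A_def R1_def E' by (rule abs_ip_le)
    then have "A\<^sup>2 \<le> (R1 * sqrt E)\<^sup>2" using abs_le_square_iff by fastforce
    then show ?thesis using E by (simp add: D_def power_mult_distrib)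
  qed
  have Rp: "0 < R1" "0 < R2" using pos by (simp_all add: R1_def R2_def)
  have s1: "R1 * sqrt E = sqrt (A\<^sup>2 + D)" using Rp E by (simp add: D_def real_sqrt_mult)
  have s2: "R2 * sqrt E = sqrt (A2\<^sup>2 + D)" using Rp E by (simp add: D2 real_sqrt_mult)
  have p1: "0 < A\<^sup>2 + D" using Rp E by (simp add: D_def)
  have p2: "0 < A2\<^sup>2 + D" using Rp E by (simp add: D2)
  define c1 c2 where "c1 = A / sqrt (A\<^sup>2 + D)" and "c2 = A2 / sqrt (A2\<^sup>2 + D)"
  have th: "\<theta> = arccos c1" "\<theta>' = arccos c2"
    unfolding \<theta>_def \<theta>'_def c1_def c2_def using s1 s2 by (simp_all add: R1_def R2_def A2_def)
  have bound: "\<bar>a / sqrt (a\<^sup>2 + D)\<bar> \<le> 1" for a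
    using D0 real_sqrt_le_mono[of "a\<^sup>2" "a\<^sup>2 + D"] by (intro abs_quot_le_1) simp
  have c: "\<bar>c1\<bar> \<le> 1" "\<bar>c2\<bar> \<le> 1" using bound by (simp_all add: c1_def c2_def)
  have "A \<le> A2" using h E by (simp add: A2)
  then have "c1 \<le> c2" unfolding c1_def c2_def by (rule div_sqrt_mono[OF _ D0 p1 p2])
  then have mono: "\<theta>' \<le> \<theta>" unfolding th using c arccos_le_arccos[of c1 c2] by auto
  have sq: "sqrt (1 - (a / sqrt (a\<^sup>2 + D))\<^sup>2) = sqrt D / sqrt (a\<^sup>2 + D)" if "0 < a\<^sup>2 + D" for a
  proof -
    have "1 - (a / sqrt (a\<^sup>2 + D))\<^sup>2 = D / (a\<^sup>2 + D)" using that by (simp add: power_divide field_simps)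
    then show ?thesis by (simp add: real_sqrt_divide)
  qed
  \<comment> \<open>The subtraction formula yields the cosine of the angle between \<open>w\<close>
    and \<open>w'\<close>; this is the exterior angle theorem.\<close>
  have "cos (\<theta> - \<theta>') = c1 * c2 + sqrt (1 - c1\<^sup>2) * sqrt (1 - c2\<^sup>2)"
    unfolding th cos_diff using c by (simp add: cos_arccos_abs sin_arccos_abs)
  also have "\<dots> = (A * A2 + D) / ((R1 * sqrt E) * (R2 * sqrt E))"
    unfolding s1 s2 using D0 by (simp add: c1_def c2_def sq p1 p2 add_divide_distrib)
  also have "A * A2 + D = E * ip P w w'"
    unfolding ww' A2 D_def by (simp add: algebra_simps power2_eq_square)
  also have "(R1 * sqrt E) * (R2 * sqrt E) = E * (R1 * R2)"
    using E by (simp add: algebra_simps)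
  finally have cosd: "cos (\<theta> - \<theta>') = ip P w w' / (R1 * R2)" using E by simp
  have "ip P (\<lambda>p. w' p / R2 - w p / R1) (\<lambda>p. w' p / R2 - w p / R1)
      = ip P w' w' / R2\<^sup>2 + ip P w w / R1\<^sup>2 - 2 * (ip P w w' / (R1 * R2))"
    by (simp add: ip_def sum_subtractf sum.distrib sum_divide_distrib sum_distrib_left
        algebra_simps power2_eq_square)
  also have "\<dots> = 2 - 2 * cos (\<theta> - \<theta>')"
    using Rp by (simp add: cosd R1[symmetric] R2'[symmetric])
  also have "\<dots> \<le> (\<theta> - \<theta>')\<^sup>2" by (rule two_minus_two_cos_le)
  finally show ?thesis
    unfolding R1_def[symmetric] R2_def[symmetric]
      L2_set_conv_ip[of "\<lambda>p. w' p / R2 - w p / R1"]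
    using mono by (intro real_le_lsqrt) auto
qed

text \<open>
  \<open>v\<close> is the velocity just after a time, so \<open>v s\<close> is the velocity on the whole flight from \<open>s\<close>
  to \<open>u\<close>, and the inequality describes the jump of the velocity at \<open>u\<close>.
\<close>

definition flight :: "'p set \<Rightarrow> (real \<Rightarrow> 'p \<Rightarrow> real) \<Rightarrow> (real \<Rightarrow> 'p \<Rightarrow> real) \<Rightarrow> real \<Rightarrow> real \<Rightarrow> bool" where
  "flight P w v s u \<longleftrightarrow> s < u \<and> (\<forall>p\<in>P. w u p = w s p + (u - s) * v s p) \<and>
        ip P (v u) (v u) = ip P (v s) (v s) \<and> ip P (w u) (v s) \<le> ip P (w u) (v u)"

text \<open>Flights are required only on short intervals with \<open>t\<close> as an endpoint. A
  jump at \<open>t\<close> thus falls at the start or the end of a flight, and no list of jump times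
  is needed.\<close>

locale expanding_path =
  fixes P :: "'p set" and T :: "real set" and w v :: "real \<Rightarrow> 'p \<Rightarrow> real"
  assumes finite_P: "finite P"
    and interval: "is_interval T"
    and nonzero: "t \<in> T \<Longrightarrow> 0 < L2_set (w t) P"
    and local_flight: "t \<in> T \<Longrightarrow> \<exists>\<delta>>0. \<forall>s\<in>T. \<forall>u\<in>T. s < u \<and> (s = t \<or> u = t) \<and> u - s < \<delta> \<longrightarrow>
        flight P w v s u"
begin

text \<open>Compactness replaces an induction over the jumps: a short interval around a point splits
  there into at most two flights, and Bolzano's bisection principle carries a transitive relation
  from short intervals to all of \<open>{s..u}\<close>.\<close>

lemma chain:
  assumes flight: "\<And>s u. s \<in> T \<Longrightarrow> u \<in> T \<Longrightarrow> flight P w v s u \<Longrightarrow> Rel s u"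
    and trans: "\<And>s t u. s \<in> T \<Longrightarrow> t \<in> T \<Longrightarrow> u \<in> T \<Longrightarrow> s < t \<Longrightarrow> t < u \<Longrightarrow> Rel s t \<Longrightarrow> Rel t u \<Longrightarrow> Rel s u"
    and st: "s \<in> T" "u \<in> T" "s < u"
  shows "Rel s u"
proof -
  have sub: "{s..u} \<subseteq> T" using mem_is_interval_1_I[OF interval st(1,2)] by auto
  let ?P = "\<lambda>a b. s \<le> a \<longrightarrow> b \<le> u \<longrightarrow> a < b \<longrightarrow> Rel a b"
  have "?P s u"
  proof (rule Bolzano[of s u ?P])
    show "s \<le> u" using st by simp
  next
    fix a b c assume h: "?P a b" "?P b c" "a \<le> b" "b \<le> c"
    show "?P a c"
    proof (intro impI)
      assume "s \<le> a" "c \<le> u" "a < c"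
      moreover from this have "a \<in> T" "b \<in> T" "c \<in> T" using h sub by auto
      ultimately show "Rel a c" using h trans[of a b c]
        by (cases "a = b \<or> b = c") auto
    qed
  next
    fix x assume x: "s \<le> x" "x \<le> u"
    then have "x \<in> T" using sub by auto
    then obtain \<delta> where \<delta>: "\<delta> > 0" "\<And>a b. a \<in> T \<Longrightarrow> b \<in> T \<Longrightarrow> a < b \<Longrightarrow> a = x \<or> b = x \<Longrightarrow> b - a < \<delta> \<Longrightarrow> flight P w v a b"
      using local_flight[of x] unfolding flight_def by blast
    show "\<exists>d>0. \<forall>a b. a \<le> x \<and> x \<le> b \<and> b - a < d \<longrightarrow> ?P a b"
    proof (intro exI[of _ \<delta>] conjI allI impI)
      fix a b assume h: "a \<le> x \<and> x \<le> b \<and> b - a < \<delta>" "s \<le> a" "b \<le> u" "a < b"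
      have T: "a \<in> T" "b \<in> T" using h sub by auto
      have 1: "a < x \<Longrightarrow> Rel a x" using flight[of a x] \<delta>(2)[of a x] h T \<open>x \<in> T\<close> by auto
      have 2: "x < b \<Longrightarrow> Rel x b" using flight[of x b] \<delta>(2)[of x b] h T \<open>x \<in> T\<close> by auto
      show "Rel a b"
      proof (cases "a = x \<or> x = b")
        case True then show ?thesis using 1 2 h by auto
      next
        case False then show ?thesis using trans[of a x b] 1 2 h T \<open>x \<in> T\<close> by auto
      qed
    qed (fact \<delta>)
  qed
  then show ?thesis using st by auto
qed

section \<open>Virial, displacement, turning and time spent in a ball\<close>

abbreviation R :: "real \<Rightarrow> real" where "R t \<equiv> L2_set (w t) P"
abbreviation I :: "real \<Rightarrow> real" where "I t \<equiv> ip P (w t) (w t)"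
abbreviation E :: "real \<Rightarrow> real" where "E t \<equiv> ip P (v t) (v t)"
abbreviation A :: "real \<Rightarrow> real" where "A t \<equiv> ip P (w t) (v t)"
definition \<theta> :: "real \<Rightarrow> real" where "\<theta> t = arccos (A t / (R t * sqrt (E t)))"

text \<open>\<open>A\<close> is half the derivative of the moment of inertia \<open>I\<close>; it
  grows at rate \<open>E\<close> in flight and jumps only upwards. The two quadratic bounds expand
  \<open>I\<close> at the earlier and at the later time. All are proved together because joining two
  intervals in the bounds on \<open>I\<close> uses the bound on \<open>A\<close>.\<close>

lemma virial:
  assumes "s \<in> T" "u \<in> T" "s < u"
  shows "E u = E s \<and> A s + E s * (u - s) \<le> A u
     \<and> I s + 2 * A s * (u - s) + E s * (u - s)\<^sup>2 \<le> I u
     \<and> I u - 2 * A u * (u - s) + E s * (u - s)\<^sup>2 \<le> I s"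
  using _ _ assms
proof (rule chain[where Rel = "\<lambda>s u. E u = E s \<and> A s + E s * (u - s) \<le> A u
     \<and> I s + 2 * A s * (u - s) + E s * (u - s)\<^sup>2 \<le> I u
     \<and> I u - 2 * A u * (u - s) + E s * (u - s)\<^sup>2 \<le> I s"])
  fix s u :: real assume st: "s \<in> T" "u \<in> T" "flight P w v s u"
  define h where "h = u - s"
  have h: "0 < h" using st by (simp add: h_def flight_def)
  let ?w = "\<lambda>p. w s p + h * v s p"
  have wu: "ip P (w u) g = ip P ?w g" for g
    by (rule ip_cong) (use st in \<open>auto simp: h_def flight_def\<close>)
  have a: "ip P (w u) (v s) = A s + h * E s" unfolding wu ip_add_scaled_left ..
  have b: "ip P (w s) (w u) = I s + h * A s"
    by (subst ip_commute) (simp add: wu ip_add_scaled_left ip_commute[of P "v s"])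
  have c: "I u = I s + 2 * h * A s + h\<^sup>2 * E s"
  proof -
    have "I u = ip P (w s) (w u) + h * ip P (v s) (w u)"
      by (subst wu) (simp add: ip_add_scaled_left)
    then show ?thesis using a b by (simp add: ip_commute[of P "v s" "w u"] algebra_simps power2_eq_square)
  qed
  have "A s + h * E s \<le> A u" using st a by (simp add: flight_def)
  then have "h * (A s + h * E s) \<le> h * A u" using h by simp
  moreover have "E u = E s" using st by (simp add: flight_def)
  ultimately show "E u = E s \<and> A s + E s * (u - s) \<le> A u
     \<and> I s + 2 * A s * (u - s) + E s * (u - s)\<^sup>2 \<le> I u
     \<and> I u - 2 * A u * (u - s) + E s * (u - s)\<^sup>2 \<le> I s"
    unfolding h_def[symmetric] using c \<open>A s + h * E s \<le> A u\<close>
    by (simp add: algebra_simps power2_eq_square)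
next
  fix s t u :: real assume "s < t" "t < u"
  define h k where "h = t - s" and "k = u - t"
  have hk: "0 < h" "0 < k" using \<open>s < t\<close> \<open>t < u\<close> by (simp_all add: h_def k_def)
  assume 1: "E t = E s \<and> A s + E s * (t - s) \<le> A t
     \<and> I s + 2 * A s * (t - s) + E s * (t - s)\<^sup>2 \<le> I t
     \<and> I t - 2 * A t * (t - s) + E s * (t - s)\<^sup>2 \<le> I s"
   and 2: "E u = E t \<and> A t + E t * (u - t) \<le> A u
     \<and> I t + 2 * A t * (u - t) + E t * (u - t)\<^sup>2 \<le> I u
     \<and> I u - 2 * A u * (u - t) + E t * (u - t)\<^sup>2 \<le> I t"
  have d: "t - s = h" "u - t = k" "u - s = h + k" by (auto simp: h_def k_def)
  have "k * (A s + E s * h) \<le> k * A t" "h * (A t + E s * k) \<le> h * A u"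
    using 1 2 hk unfolding d by (auto intro: mult_left_mono)
  then show "E u = E s \<and> A s + E s * (u - s) \<le> A u
     \<and> I s + 2 * A s * (u - s) + E s * (u - s)\<^sup>2 \<le> I u
     \<and> I u - 2 * A u * (u - s) + E s * (u - s)\<^sup>2 \<le> I s"
    using 1 2 unfolding d by (auto simp: algebra_simps power2_eq_square)
qed

lemma energy_constant: "s \<in> T \<Longrightarrow> u \<in> T \<Longrightarrow> E u = E s"
  using virial[of s u] virial[of u s] by (cases s u rule: linorder_cases) auto

lemma displacement_le:
  assumes "s \<in> T" "u \<in> T" "s < u"
  shows "L2_set (\<lambda>p. w u p - w s p) P \<le> sqrt (E s) * (u - s)"
  using _ _ assms
proof (rule chain[where Rel = "\<lambda>s u. L2_set (\<lambda>p. w u p - w s p) P \<le> sqrt (E s) * (u - s)"])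
  fix s u :: real assume st: "s \<in> T" "u \<in> T" "flight P w v s u"
  have "L2_set (\<lambda>p. w u p - w s p) P = L2_set (\<lambda>p. (u - s) * v s p) P"
    by (rule L2_set_cong) (use st in \<open>auto simp: flight_def\<close>)
  also have "\<dots> = (u - s) * L2_set (v s) P"
    by (rule L2_set_right_distrib[symmetric]) (use st in \<open>auto simp: flight_def\<close>)
  finally show "L2_set (\<lambda>p. w u p - w s p) P \<le> sqrt (E s) * (u - s)"
    by (simp add: L2_set_conv_ip mult.commute)
next
  fix s t u :: real assume st: "s \<in> T" "t \<in> T" "u \<in> T"
   and 1: "L2_set (\<lambda>p. w t p - w s p) P \<le> sqrt (E s) * (t - s)"
   and 2: "L2_set (\<lambda>p. w u p - w t p) P \<le> sqrt (E t) * (u - t)"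
  have "L2_set (\<lambda>p. w u p - w s p) P \<le> L2_set (\<lambda>p. w u p - w t p) P + L2_set (\<lambda>p. w t p - w s p) P"
    using L2_set_triangle_ineq[of "\<lambda>p. w u p - w t p" "\<lambda>p. w t p - w s p" P] by simp
  also have "\<dots> \<le> sqrt (E s) * (u - s)"
    using 1 2 energy_constant[OF st(1,2)] by (simp add: algebra_simps)
  finally show "L2_set (\<lambda>p. w u p - w s p) P \<le> sqrt (E s) * (u - s)" .
qed

lemma abs_A_le: "\<bar>A t\<bar> \<le> R t * sqrt (E t)"
  using abs_ip_le[of P "w t" "v t"] by (simp add: L2_set_conv_ip)

lemma \<theta>_bounds: "0 \<le> \<theta> t" "\<theta> t \<le> pi"
proof -
  have "\<bar>A t / (R t * sqrt (E t))\<bar> \<le> 1" by (rule abs_quot_le_1) (rule abs_A_le)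
  then show "0 \<le> \<theta> t" "\<theta> t \<le> pi"
    unfolding \<theta>_def by (auto simp only: abs_le_iff intro!: arccos_lbound arccos_ubound)
qed

text \<open>In flight \<open>angle_along_ray\<close> bounds the chord. Over successive flights
  chords add up by the triangle inequality, while the drops of \<theta> telescope.\<close>

lemma turning_le:
  assumes "s \<in> T" "u \<in> T" "s < u" "0 < E s"
  shows "L2_set (\<lambda>p. w u p / R u - w s p / R s) P \<le> \<theta> s - \<theta> u"
  using _ _ assms(1-3)
proof (rule chain[where Rel = "\<lambda>s u. L2_set (\<lambda>p. w u p / R u - w s p / R s) P \<le> \<theta> s - \<theta> u"])
  fix s' u' assume st: "s' \<in> T" "u' \<in> T" "flight P w v s' u'"
  have E: "0 < E s'" using assms(4) energy_constant[OF assms(1) st(1)] by simp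
  define h where "h = u' - s'"
  define W where "W = (\<lambda>p. w s' p + h * v s' p)"
  have wu: "\<And>p. p \<in> P \<Longrightarrow> w u' p = W p" using st by (auto simp: W_def h_def flight_def)
  have RW: "L2_set W P = R u'" using wu by (auto intro: L2_set_cong)
  have AW: "ip P W (v s') = ip P (w u') (v s')" using wu by (auto intro: ip_cong)
  have 1: "L2_set (\<lambda>p. W p / L2_set W P - w s' p / R s') P
     \<le> \<theta> s' - arccos (ip P W (v s') / (L2_set W P * sqrt (E s')))"
    unfolding \<theta>_def W_def
    by (rule angle_along_ray)
      (use st E nonzero[OF st(1)] nonzero[OF st(2)] RW in \<open>auto simp: h_def flight_def W_def\<close>)
  have q: "ip P (w u') (v s') \<le> A u'" "E u' = E s'" using st by (auto simp: flight_def)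
  have pos: "0 < R u' * sqrt (E s')" using nonzero[OF st(2)] E by simp
  \<comment> \<open>The jump at \<open>u'\<close> keeps the speed and can only raise the virial, so
    it can only lower the angle.\<close>
  have "\<theta> u' \<le> arccos (ip P (w u') (v s') / (R u' * sqrt (E s')))"
    unfolding \<theta>_def q(2)
  proof (rule arccos_le_arccos)
    have "\<bar>ip P (w u') (v s')\<bar> \<le> R u' * sqrt (E s')"
      using abs_ip_le[of P "w u'" "v s'"] by (simp add: L2_set_conv_ip)
    from abs_quot_le_1[OF this] show "- 1 \<le> ip P (w u') (v s') / (R u' * sqrt (E s'))" by linarith
    show "ip P (w u') (v s') / (R u' * sqrt (E s')) \<le> A u' / (R u' * sqrt (E s'))"
      using q pos by (intro divide_right_mono) auto
    have "\<bar>A u'\<bar> \<le> R u' * sqrt (E s')" using abs_A_le[of u'] q by simp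
    from abs_quot_le_1[OF this] show "A u' / (R u' * sqrt (E s')) \<le> 1" by linarith
  qed
  moreover have "L2_set (\<lambda>p. W p / L2_set W P - w s' p / R s') P = L2_set (\<lambda>p. w u' p / R u' - w s' p / R s') P"
    unfolding RW by (rule L2_set_cong) (auto simp: wu)
  ultimately show "L2_set (\<lambda>p. w u' p / R u' - w s' p / R s') P \<le> \<theta> s' - \<theta> u'"
    using 1 unfolding RW AW by linarith
next
  fix s t u :: real
  assume 1: "L2_set (\<lambda>p. w t p / R t - w s p / R s) P \<le> \<theta> s - \<theta> t"
   and 2: "L2_set (\<lambda>p. w u p / R u - w t p / R t) P \<le> \<theta> t - \<theta> u"
  show "L2_set (\<lambda>p. w u p / R u - w s p / R s) P \<le> \<theta> s - \<theta> u"
    using 1 2 L2_set_triangle_ineq[of "\<lambda>p. w u p / R u - w t p / R t" "\<lambda>p. w t p / R t - w s p / R s" P] by simp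
qed

text \<open>\<open>I\<close> is strongly convex: expanded from the midpoint \<open>m\<close> towards
  both ends, the linear terms cancel in the sum. Since \<open>I m\<close> is nonnegative,
  \<open>E s * h\<^sup>2\<close> is at most \<open>L\<^sup>2\<close>.\<close>

lemma compact_time_le:
  assumes "s \<in> T" "u \<in> T" "s < u" "R s \<le> L" "R u \<le> L" "0 < E s"
  shows "u - s \<le> 2 * L / sqrt (E s)"
proof -
  define m h where "m = (s + u) / 2" and "h = (u - s) / 2"
  have m: "s < m" "m < u" "m - s = h" "u - m = h" using assms by (auto simp: m_def h_def field_simps)
  have mT: "m \<in> T" using mem_is_interval_1_I[OF interval assms(1,2)] m by simp
  have "I m + 2 * A m * h + E s * h\<^sup>2 \<le> I u"
    using virial[OF mT assms(2) m(2)] energy_constant[OF assms(1) mT] m by simp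
  moreover have "I m - 2 * A m * h + E s * h\<^sup>2 \<le> I s"
    using virial[OF assms(1) mT m(1)] m by simp
  moreover have "I s \<le> L\<^sup>2" "I u \<le> L\<^sup>2"
    using assms(4,5) power_mono[of "R s" L 2] power_mono[of "R u" L 2]
    by (simp_all add: L2_set_conv_ip ip_self_nonneg)
  moreover have "0 \<le> I m" by (rule ip_self_nonneg)
  ultimately have "E s * h\<^sup>2 \<le> L\<^sup>2" by linarith
  then have "(sqrt (E s) * h)\<^sup>2 \<le> L\<^sup>2" using assms by (simp add: power_mult_distrib)
  moreover have "0 \<le> L" using assms(4) nonzero[OF assms(1)] by linarith
  ultimately have "sqrt (E s) * h \<le> L" by (rule power2_le_imp_le)
  then show ?thesis using assms by (simp add: h_def field_simps)
qed

text \<open>As \<open>A\<close> never decreases, it changes sign at most once: \<open>R\<close> does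
  not increase while \<open>A\<close> is negative and does not decrease afterwards. On an interval
  where \<open>A\<close> keeps its sign the least \<open>R\<close> is therefore at an end.\<close>

lemma R_mono_forward:
  assumes "s \<in> T" "u \<in> T" "s \<le> u" "0 \<le> A s"
  shows "R s \<le> R u" "0 \<le> A u"
proof -
  have "I s \<le> I u \<and> 0 \<le> A u"
  proof (cases "s = u")
    case False
    then have "s < u" using assms by simp
    have "0 \<le> 2 * A s * (u - s)" "0 \<le> E s * (u - s)\<^sup>2" "0 \<le> E s * (u - s)"
      using assms ip_self_nonneg[of P "v s"] by auto
    then show ?thesis using virial[OF assms(1,2) \<open>s < u\<close>] assms(4) by linarith
  qed (use assms in auto)
  then show "R s \<le> R u" "0 \<le> A u" by (simp_all add: L2_set_conv_ip)
qed

lemma R_mono_backward: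
  assumes "s \<in> T" "u \<in> T" "s \<le> u" "A u < 0"
  shows "R u \<le> R s" "A s < 0"
proof -
  have "I u \<le> I s \<and> A s < 0"
  proof (cases "s = u")
    case False
    then have "s < u" using assms by simp
    have "0 \<le> E s * (u - s)\<^sup>2" "0 \<le> E s * (u - s)"
      using assms ip_self_nonneg[of P "v s"] by auto
    moreover have "2 * A u * (u - s) \<le> 0" using assms by (simp add: mult_nonpos_nonneg)
    ultimately show ?thesis using virial[OF assms(1,2) \<open>s < u\<close>] assms(4) by linarith
  qed (use assms in auto)
  then show "R u \<le> R s" "A s < 0" by (simp_all add: L2_set_conv_ip)
qed

end

section \<open>Collisions are isolated in time\<close>

lemma inner_prod_diff_left:
  "inner_prod d (\<lambda>i. f i - g i) h = inner_prod d f h - inner_prod d g h"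
  by (simp add: inner_prod_def algebra_simps sum_subtractf)

lemma center_dist_commute: "center_dist d x t j k = center_dist d x t k j"
  unfolding center_dist_def by (rule L2_set_minus_commute)

lemma collide_sym: "collide n d x t j k \<Longrightarrow> collide n d x t k j"
  by (auto simp: collide_def center_dist_commute)

lemma center_dist_square:
  "(center_dist d x t j k)\<^sup>2 = inner_prod d (\<lambda>i. x j t i - x k t i) (\<lambda>i. x j t i - x k t i)"
  by (simp add: center_dist_def L2_set_def inner_prod_def sum_nonneg power2_eq_square)

section \<open>Free flight and the collision law\<close>

context hard_ball_evolution
begin

lemma continuous_coordinate:
  assumes "k < n" shows "continuous_on UNIV (\<lambda>s. x k s i)"
proof -
  have "continuous_map euclideanreal (powertop_real UNIV) (x k)"
    using continuous[OF assms] by (simp add: Euclidean_space_def continuous_map_in_subtopology)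
  then show ?thesis
    by (simp add: continuous_map_componentwise_UNIV)
qed

lemma continuous_center_dist:
  assumes "j < n" "k < n" shows "continuous_on UNIV (\<lambda>s. center_dist d x s j k)"
  unfolding center_dist_def L2_set_def
  by (intro continuous_intros continuous_coordinate assms)

lemma has_velocity_before:
  assumes "k < n"
  shows "((\<lambda>s. x k s i) has_real_derivative vel_before x k t i) (at_left t)"
  using velocity_left_exists[OF assms]
  by (simp add: vel_before_def vector_derivative_works has_real_derivative_iff_has_vector_derivative)

lemma has_velocity_after:
  assumes "k < n"
  shows "((\<lambda>s. x k s i) has_real_derivative vel_after x k t i) (at_right t)"
  using velocity_right_exists[OF assms]
  by (simp add: vel_after_def vector_derivative_works has_real_derivative_iff_has_vector_derivative)

text \<open>Inside the interval both one-sided velocities equal one vector \<open>w\<close>, so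
  \<open>x k r i - r * w i\<close> has derivative zero and is constant, by continuity up to both
  ends. The right derivative at \<open>s\<close> and the left derivative at \<open>u\<close> are
  then \<open>w\<close> as well.\<close>

lemma free_flight:
  assumes k: "k < n" and su: "s < u" and free: "\<And>t j. s < t \<Longrightarrow> t < u \<Longrightarrow> \<not> collide n d x t j k"
  shows "r \<in> {s..u} \<Longrightarrow> x k r i = x k s i + (r - s) * vel_after x k s i"
    and "vel_before x k u i = vel_after x k s i"
proof -
  have "\<exists>w. \<forall>t\<in>{s<..<u}. vel_before x k t = w \<and> vel_after x k t = w"
    by (rule velocity_constant_between_collisions[OF k su free])
  then obtain w where w: "\<And>t. s < t \<Longrightarrow> t < u \<Longrightarrow> vel_before x k t = w \<and> vel_after x k t = w"
    by force
  let ?g = "\<lambda>r. x k r i - r * w i"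
  have "\<exists>c. \<forall>r\<in>{s<..<u}. ?g r = c"
  proof (rule has_field_derivative_zero_constant)
    fix r assume r: "r \<in> {s<..<u}"
    have "((\<lambda>s. x k s i) has_real_derivative w i) (at r)"
      using has_velocity_before[OF k, of i r] has_velocity_after[OF k, of i r] w[of r] r
      by (simp add: has_field_derivative_iff filterlim_at_split)
    then have "(?g has_real_derivative 0) (at r)"
      by (auto intro!: derivative_eq_intros)
    then show "(?g has_real_derivative 0) (at r within {s<..<u})"
      by (rule has_field_derivative_at_within)
  qed auto
  then obtain c where c: "\<And>r. s < r \<Longrightarrow> r < u \<Longrightarrow> ?g r = c" by force
  have g: "x k r i = c + r * w i" if "r \<in> {s..u}" for r
  proof -
    have "?g r = c"
    proof (rule continuous_constant_on_closure[of "{s<..<u}" ?g c r])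
      show "continuous_on (closure {s<..<u}) ?g"
        by (intro continuous_intros continuous_on_subset[OF continuous_coordinate[OF k]]) auto
    qed (use c that su in auto)
    then show ?thesis by simp
  qed
  have "((\<lambda>r. (x k r i - x k s i) / (r - s)) \<longlongrightarrow> w i) (at_right s)"
  proof (rule tendsto_eventually)
    show "\<forall>\<^sub>F r in at_right s. (x k r i - x k s i) / (r - s) = w i"
      unfolding eventually_at_right[OF su] using su g
      by (intro exI[of _ u]) (auto simp: divide_simps algebra_simps)
  qed
  then have 1: "vel_after x k s i = w i"
    using has_velocity_after[OF k, of i s] tendsto_unique[OF trivial_limit_at_right_real]
    unfolding has_field_derivative_iff by blast
  have "((\<lambda>r. (x k r i - x k u i) / (r - u)) \<longlongrightarrow> w i) (at_left u)"
  proof (rule tendsto_eventually)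
    show "\<forall>\<^sub>F r in at_left u. (x k r i - x k u i) / (r - u) = w i"
      unfolding eventually_at_left[OF su] using su g
      by (intro exI[of _ s]) (auto simp: divide_simps algebra_simps)
  qed
  then have 2: "vel_before x k u i = w i"
    using has_velocity_before[OF k, of i u] tendsto_unique[OF trivial_limit_at_left_real]
    unfolding has_field_derivative_iff by blast
  show "r \<in> {s..u} \<Longrightarrow> x k r i = x k s i + (r - s) * vel_after x k s i"
    using g[of r] g[of s] su unfolding 1 by (auto simp: algebra_simps)
  show "vel_before x k u i = vel_after x k s i" by (simp add: 1 2)
qed

text \<open>Touching centers are at distance 2, so the unit normal is \<open>y / 2\<close>. The
  exchange of normal components becomes an impulse along \<open>y\<close>; the 4 in \<alpha> comes
  from using the unit normal twice.\<close>

lemma collision_law: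
  assumes c: "collide n d x t j k"
  defines "y \<equiv> \<lambda>i. x j t i - x k t i"
  defines "\<alpha> \<equiv> inner_prod d (\<lambda>i. vel_before x j t i - vel_before x k t i) y / 4"
  shows "\<alpha> < 0" "inner_prod d y y = 4"
    "vel_after x j t i = vel_before x j t i - \<alpha> * y i"
    "vel_after x k t i = vel_before x k t i + \<alpha> * y i"
proof -
  show "\<alpha> < 0" using approaching[OF c] by (simp add: \<alpha>_def y_def)
  have dist: "center_dist d x t j k = 2" "center_dist d x t k j = 2"
    using c by (auto simp: collide_def center_dist_commute)
  then show "inner_prod d y y = 4" unfolding y_def using center_dist_square[of d x t j k] by simp
  have dir: "center_dir d x t j k = (\<lambda>i. y i / 2)" "center_dir d x t k j = (\<lambda>i. - y i / 2)"
    by (simp_all add: center_dir_def dist y_def fun_eq_iff)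
  have half: "inner_prod d f (\<lambda>i. y i / 2) = inner_prod d f y / 2"
    "inner_prod d f (\<lambda>i. - y i / 2) = - inner_prod d f y / 2" for f
    by (simp_all add: inner_prod_def sum_divide_distrib sum_negf)
  have a: "\<alpha> = (inner_prod d (vel_before x j t) y - inner_prod d (vel_before x k t) y) / 4"
    by (simp add: \<alpha>_def inner_prod_diff_left)
  show "vel_after x j t i = vel_before x j t i - \<alpha> * y i"
    unfolding elastic[OF c] dir half a by (simp add: field_simps)
  show "vel_after x k t i = vel_before x k t i + \<alpha> * y i"
    unfolding elastic[OF collide_sym[OF c]] dir half a by (simp add: field_simps)
qed

text \<open>The collision reverses the normal relative velocity: its product with \<open>y\<close>
  goes from \<open>4 * \<alpha>\<close> to \<open>- 4 * \<alpha>\<close>.\<close>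

lemma separating:
  assumes c: "collide n d x t j k"
  shows "0 < inner_prod d (\<lambda>i. vel_after x j t i - vel_after x k t i) (\<lambda>i. x j t i - x k t i)"
proof -
  define y where "y = (\<lambda>i. x j t i - x k t i)"
  define \<alpha> where "\<alpha> = inner_prod d (\<lambda>i. vel_before x j t i - vel_before x k t i) y / 4"
  note law = collision_law[OF c, folded y_def, folded \<alpha>_def]
  have a: "inner_prod d (vel_before x j t) y - inner_prod d (vel_before x k t) y = 4 * \<alpha>"
    by (simp add: \<alpha>_def inner_prod_diff_left)
  have "(\<lambda>i. vel_after x j t i - vel_after x k t i)
      = (\<lambda>i. (vel_before x j t i - vel_before x k t i) - 2 * \<alpha> * y i)"
    by (simp add: law(3,4) fun_eq_iff) (simp add: y_def)
  moreover have "inner_prod d (\<lambda>i. 2 * \<alpha> * y i) y = 2 * \<alpha> * inner_prod d y y"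
    by (simp add: inner_prod_def sum_distrib_left mult.assoc)
  ultimately have "inner_prod d (\<lambda>i. vel_after x j t i - vel_after x k t i) y = 4 * \<alpha> - 2 * \<alpha> * inner_prod d y y"
    using a by (simp add: inner_prod_diff_left)
  then show ?thesis using law(1,2) by (simp add: y_def)
qed

section \<open>Repeated collisions of a pair and isolation of collision times\<close>

lemma touching_partner_unique:
  assumes "j < n" "k < n" "l < n" "j \<noteq> k" "j \<noteq> l"
    and "center_dist d x t j k = 2" "center_dist d x t j l = 2"
  shows "k = l"
proof (rule ccontr)
  assume "k \<noteq> l"
  let ?N = "near n d x 0 t"
  have "(j, k) \<in> ?N" "(k, j) \<in> ?N" "(j, l) \<in> ?N" "(l, j) \<in> ?N"
    using assms by (auto simp: near_def center_dist_commute)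
  then have "{j, k, l} \<times> {j, k, l} \<subseteq> ?N\<^sup>*"
    by (auto intro: r_into_rtrancl rtrancl_trans)
  moreover have "{j, k, l} \<subseteq> {..<n}" "3 \<le> card {j, k, l}"
    using assms \<open>k \<noteq> l\<close> by auto
  ultimately show False using no_simultaneous_collisions by blast
qed

lemma collision_partner_unique:
  "collide n d x t j k \<Longrightarrow> collide n d x t j l \<Longrightarrow> k = l"
  using touching_partner_unique[of j k l t] by (auto simp: collide_def)

text \<open>Neither ball has another partner in the window, so after \<open>t1\<close> both fly
  freely until they meet again. They start out separating, and in free flight the squared distance
  \<open>f\<close> is convex, so it cannot come back to 4.\<close>

lemma at_most_one_collision:
  assumes sub: "\<And>t l. s < t \<Longrightarrow> t < u \<Longrightarrow> collide n d x t l j \<Longrightarrow> l = k"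
      "\<And>t l. s < t \<Longrightarrow> t < u \<Longrightarrow> collide n d x t l k \<Longrightarrow> l = j"
    and c1: "collide n d x t1 j k" "s < t1" "t1 < t2" and c2: "collide n d x t2 j k" "t2 < u"
  shows False
proof -
  have jk: "j < n" "k < n" using c1 by (auto simp: collide_def)
  define W where "W = inner_prod d (\<lambda>i. vel_after x j t1 i - vel_after x k t1 i) (\<lambda>i. x j t1 i - x k t1 i)"
  have W: "0 < W" unfolding W_def by (rule separating[OF c1(1)])
  define f where "f = (\<lambda>s. \<Sum>i<d. (x j s i - x k s i)\<^sup>2)"
  have f: "f s = (center_dist d x s j k)\<^sup>2" for s
    by (simp add: f_def center_dist_def L2_set_def sum_nonneg)
  have f4: "f s = 4" if "collide n d x s j k" for s using that by (simp add: f collide_def)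
  have contf: "continuous_on UNIV f"
    unfolding f_def by (intro continuous_intros continuous_coordinate jk)
  \<comment> \<open>The positive right derivative excludes further collisions of the pair shortly
    after \<open>t1\<close>; hence the infimum of the later ones lies strictly after
    \<open>t1\<close>.\<close>
  have "(f has_real_derivative 2 * W) (at_right t1)"
    unfolding f_def W_def inner_prod_def
    by (auto intro!: derivative_eq_intros has_velocity_after jk sum.cong simp: sum_distrib_left)
  from has_real_derivative_pos_inc_right[OF this] W obtain \<epsilon> where
    \<epsilon>: "\<epsilon> > 0" "\<And>h. 0 < h \<Longrightarrow> h < \<epsilon> \<Longrightarrow> f t1 < f (t1 + h)" by auto
  define Z where "Z = {s. t1 < s \<and> collide n d x s j k}"
  have late: "t1 + \<epsilon> \<le> s" if "s \<in> Z" for s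
    using \<epsilon>(2)[of "s - t1"] that f4[of s] f4[OF c1(1)] by (force simp: Z_def)
  have "t2 \<in> Z" using c1 c2 by (simp add: Z_def)
  \<comment> \<open>\<open>Z\<close> need not have a least element, so the argument runs at its
    infimum: \<open>f\<close> exceeds 4 there and, by continuity, nearby, which keeps
    \<open>Z\<close> away from \<sigma>.\<close>
  define \<sigma> where "\<sigma> = Inf Z"
  have bdd: "bdd_below Z" using late by (auto simp: bdd_below_def)
  have \<sigma>1: "t1 + \<epsilon> \<le> \<sigma>" unfolding \<sigma>_def using \<open>t2 \<in> Z\<close> late by (intro cInf_greatest) auto
  have \<sigma>2: "\<sigma> \<le> t2" unfolding \<sigma>_def using \<open>t2 \<in> Z\<close> bdd by (rule cInf_lower)
  have noZ: "r \<notin> Z" if "r < \<sigma>" for r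
    using that cInf_lower[OF _ bdd, of r] by (auto simp: \<sigma>_def)
  have free: "\<not> collide n d x r l j" "\<not> collide n d x r l k" if "t1 < r" "r < \<sigma>" for r l
    using sub[of r l] noZ[OF that(2)] that \<sigma>2 c2(2) c1(2) by (auto simp: Z_def dest: collide_sym)
  define h where "h = \<sigma> - t1"
  have h: "0 < h" using \<sigma>1 \<epsilon> by (simp add: h_def)
  then have lt: "t1 < \<sigma>" by (simp add: h_def)
  have pos: "x j \<sigma> i = x j t1 i + h * vel_after x j t1 i" "x k \<sigma> i = x k t1 i + h * vel_after x k t1 i" for i
    using free_flight(1)[OF jk(1) lt, of \<sigma> i] free_flight(1)[OF jk(2) lt, of \<sigma> i] free lt
    by (auto simp: h_def)
  have "f \<sigma> = f t1 + 2 * h * W + h\<^sup>2 * (\<Sum>i<d. (vel_after x j t1 i - vel_after x k t1 i)\<^sup>2)"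
    unfolding f_def W_def inner_prod_def pos sum_distrib_left sum.distrib[symmetric]
    by (rule sum.cong) (auto simp: algebra_simps power2_eq_square)
  moreover have "0 \<le> h\<^sup>2 * (\<Sum>i<d. (vel_after x j t1 i - vel_after x k t1 i)\<^sup>2)"
    by (simp add: sum_nonneg)
  moreover have "0 < 2 * h * W" using h W by simp
  ultimately have "4 < f \<sigma>" using f4[OF c1(1)] by linarith
  moreover have "isCont f \<sigma>" using contf by (simp add: continuous_on_eq_continuous_at)
  ultimately have "\<forall>\<^sub>F r in at \<sigma>. 4 < f r" by (simp add: isCont_def order_tendstoD)
  then obtain e where e: "e > 0" "\<And>r. r \<noteq> \<sigma> \<Longrightarrow> dist r \<sigma> < e \<Longrightarrow> 4 < f r"
    by (auto simp: eventually_at)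
  have "\<sigma> + e \<le> r" if "r \<in> Z" for r
  proof (rule ccontr)
    assume "\<not> \<sigma> + e \<le> r"
    then have "dist r \<sigma> < e" using noZ[of r] that by (force simp: dist_real_def)
    then have "4 < f r" using e(2)[of r] \<open>4 < f \<sigma>\<close> by (cases "r = \<sigma>") auto
    then show False using f4[of r] that by (simp add: Z_def)
  qed
  then have "\<sigma> + e \<le> \<sigma>" unfolding \<sigma>_def using \<open>t2 \<in> Z\<close> by (intro cInf_greatest) auto
  then show False using e by simp
qed

text \<open>
  Near a given time only the pairs touching at that time can collide, hence each ball has at most
  one possible partner.
\<close>

lemma collision_times_isolated:
  obtains \<delta> where "\<delta> > 0" "\<And>s j k. collide n d x s j k \<Longrightarrow> \<bar>s - t\<bar> < \<delta> \<Longrightarrow> s = t"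
proof -
  have "\<exists>\<delta>>0. \<forall>s. \<bar>s - t\<bar> < \<delta> \<longrightarrow> center_dist d x s j k \<noteq> 2"
    if jk: "j < n" "k < n" "center_dist d x t j k \<noteq> 2" for j k
  proof -
    have "isCont (\<lambda>s. center_dist d x s j k) t"
      using continuous_center_dist[OF jk(1,2)] by (simp add: continuous_on_eq_continuous_at)
    from continuous_at_avoid[OF this jk(3)] show ?thesis
      by (auto simp: dist_real_def abs_minus_commute)
  qed
  then obtain D where D: "\<And>j k. j < n \<Longrightarrow> k < n \<Longrightarrow> center_dist d x t j k \<noteq> 2 \<Longrightarrow>
      0 < D j k \<and> (\<forall>s. \<bar>s - t\<bar> < D j k \<longrightarrow> center_dist d x s j k \<noteq> 2)"
    by metis
  define Q where "Q = {(j, k). j < n \<and> k < n \<and> center_dist d x t j k \<noteq> 2}"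
  have "finite Q" by (rule finite_subset[of _ "{..<n} \<times> {..<n}"]) (auto simp: Q_def)
  \<comment> \<open>Within this radius no pair that is apart at \<open>t\<close> can touch. The
    inserted 1 keeps the minimum defined when \<open>Q\<close> is empty.\<close>
  define \<delta>1 where "\<delta>1 = Min (insert 1 (case_prod D ` Q))"
  have \<delta>1: "0 < \<delta>1" "\<And>j k. (j, k) \<in> Q \<Longrightarrow> \<delta>1 \<le> D j k"
    using \<open>finite Q\<close> D by (auto simp: \<delta>1_def Q_def intro!: Min_le)
  have touch: "center_dist d x t j k = 2" if "collide n d x s j k" "\<bar>s - t\<bar> < \<delta>1" for s j k
  proof (rule ccontr)
    assume "center_dist d x t j k \<noteq> 2"
    then have "(j, k) \<in> Q" using that by (auto simp: Q_def collide_def)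
    then have "\<bar>s - t\<bar> < D j k" using \<delta>1 that by force
    then show False using D[of j k] that \<open>center_dist d x t j k \<noteq> 2\<close> by (auto simp: collide_def)
  qed
  have partner: "k = l" if "collide n d x s j k" "\<bar>s - t\<bar> < \<delta>1" "collide n d x r j l" "\<bar>r - t\<bar> < \<delta>1" for s r j k l
    using touching_partner_unique[of j k l t] touch[OF that(1,2)] touch[OF that(3,4)] that
    by (auto simp: collide_def)
  \<comment> \<open>Each collision time in the window is sent to one of its colliding pairs. No pair
    collides twice there, so this map is injective and \<open>Z\<close> is finite.\<close>
  define Z where "Z = {s. \<bar>s - t\<bar> < \<delta>1 \<and> (\<exists>j k. collide n d x s j k)}"
  define pr where "pr = (\<lambda>s. SOME jk. collide n d x s (fst jk) (snd jk))"
  have pr: "collide n d x s (fst (pr s)) (snd (pr s))" if "s \<in> Z" for s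
    unfolding pr_def by (rule someI_ex) (use that in \<open>auto simp: Z_def\<close>)
  have once: False if r: "r \<in> Z" "s \<in> Z" "pr r = pr s" "r < s" for r s
  proof (rule at_most_one_collision[of "t - \<delta>1" "t + \<delta>1" "fst (pr r)" "snd (pr r)" r s])
    have win: "\<bar>r - t\<bar> < \<delta>1" "\<bar>s - t\<bar> < \<delta>1" using r by (auto simp: Z_def)
    show "l = snd (pr r)" if "t - \<delta>1 < q" "q < t + \<delta>1" "collide n d x q l (fst (pr r))" for q l
      using partner[OF collide_sym[OF that(3)] _ pr[OF r(1)] win(1)] that by (auto simp: abs_less_iff)
    show "l = fst (pr r)" if "t - \<delta>1 < q" "q < t + \<delta>1" "collide n d x q l (snd (pr r))" for q l
      using partner[OF collide_sym[OF that(3)] _ collide_sym[OF pr[OF r(1)]] win(1)] that by (auto simp: abs_less_iff)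
    show "collide n d x s (fst (pr r)) (snd (pr r))" using pr[OF r(2)] r(3) by simp
  qed (use r pr[OF r(1)] in \<open>auto simp: Z_def abs_less_iff\<close>)
  then have "inj_on pr Z" by (metis inj_onI linorder_neqE_linordered_idom)
  moreover have "pr ` Z \<subseteq> {..<n} \<times> {..<n}"
  proof (rule image_subsetI)
    show "pr s \<in> {..<n} \<times> {..<n}" if "s \<in> Z" for s
      using pr[OF that] by (auto simp: collide_def mem_Times_iff)
  qed
  ultimately have "finite Z" by (meson finite_SigmaI finite_lessThan inj_on_finite)
  define \<delta> where "\<delta> = Min (insert \<delta>1 ((\<lambda>s. \<bar>s - t\<bar>) ` (Z - {t})))"
  have "\<delta> > 0" using \<open>finite Z\<close> \<delta>1 by (auto simp: \<delta>_def)
  moreover have "s = t" if "collide n d x s j k" "\<bar>s - t\<bar> < \<delta>" for s j k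
  proof (rule ccontr)
    assume "s \<noteq> t"
    have "\<delta> \<le> \<delta>1" using \<open>finite Z\<close> by (simp add: \<delta>_def)
    then have "s \<in> Z - {t}" using that \<open>s \<noteq> t\<close> by (auto simp: Z_def)
    then have "\<delta> \<le> \<bar>s - t\<bar>" using \<open>finite Z\<close> by (auto simp: \<delta>_def intro!: Min_le)
    then show False using that by simp
  qed
  ultimately show thesis by (rule that)
qed

end

section \<open>The centered path of an isolated family\<close>

text \<open>Configuration space has coordinates \<open>(k, i)\<close>, ball and axis, and the map
  serves both positions and velocities. With the mean removed, a large norm means that the balls are
  spread out, wherever the family is.\<close>

definition centered :: "nat set \<Rightarrow> (nat \<Rightarrow> nat \<Rightarrow> real) \<Rightarrow> nat \<times> nat \<Rightarrow> real" where
  "centered S f = (\<lambda>(k, i). f k i - (\<Sum>l\<in>S. f l i) / real (card S))"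

lemma sum_centered_products:
  assumes "finite S" "S \<noteq> {}"
  shows "(\<Sum>k\<in>S. (a k - (\<Sum>l\<in>S. a l) / real (card S)) * (b k - (\<Sum>l\<in>S. b l) / real (card S)))
    = (\<Sum>k\<in>S. a k * b k) - (\<Sum>l\<in>S. a l) * (\<Sum>l\<in>S. b l) / real (card S)"
proof -
  have m: "real (card S) \<noteq> 0" using assms by simp
  define \<alpha> \<beta> where "\<alpha> = (\<Sum>l\<in>S. a l)" and "\<beta> = (\<Sum>l\<in>S. b l)"
  have "(\<Sum>k\<in>S. (a k - \<alpha> / real (card S)) * (b k - \<beta> / real (card S)))
    = (\<Sum>k\<in>S. a k * b k) - \<alpha> * \<beta> / real (card S) - \<alpha> * \<beta> / real (card S)
      + real (card S) * (\<alpha> / real (card S)) * (\<beta> / real (card S))"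
    by (simp add: algebra_simps sum.distrib sum_subtractf \<alpha>_def \<beta>_def
        sum_distrib_left[symmetric] sum_distrib_right[symmetric] sum_divide_distrib[symmetric])
  then show ?thesis using m by (simp add: \<alpha>_def \<beta>_def)
qed

lemma ip_Times: "ip (S \<times> {..<d}) f g = (\<Sum>i<d. \<Sum>k\<in>S. f (k, i) * g (k, i))"
  unfolding ip_def by (subst sum.swap) (simp add: sum.cartesian_product)

text \<open>Centering costs only a product of sums. For velocities the sum is the momentum, so
  conservation laws pass to the centered path.\<close>

lemma ip_centered:
  assumes "finite S" "S \<noteq> {}"
  shows "ip (S \<times> {..<d}) (centered S f) (centered S g) = (\<Sum>k\<in>S. inner_prod d (f k) (g k))
      - inner_prod d (\<lambda>i. \<Sum>l\<in>S. f l i) (\<lambda>i. \<Sum>l\<in>S. g l i) / real (card S)"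
proof -
  have "(\<Sum>k\<in>S. inner_prod d (f k) (g k)) = (\<Sum>i<d. \<Sum>k\<in>S. f k i * g k i)"
    unfolding inner_prod_def by (rule sum.swap)
  then show ?thesis
    unfolding ip_Times centered_def
    by (simp add: sum_centered_products[OF assms] sum_subtractf) (simp add: inner_prod_def sum_divide_distrib)
qed

lemma L2_set_slice_le:
  assumes "finite S" "j \<in> S"
  shows "L2_set (\<lambda>i. f (j, i)) {..<d} \<le> L2_set f (S \<times> {..<d::nat})"
proof -
  have "(\<Sum>i<d. (f (j, i))\<^sup>2) \<le> (\<Sum>i<d. \<Sum>k\<in>S. (f (k, i))\<^sup>2)"
    by (rule sum_mono) (rule member_le_sum[of j S "\<lambda>k. (f (k, _))\<^sup>2"], use assms in auto)
  also have "\<dots> = ip (S \<times> {..<d}) f f" by (simp add: ip_Times power2_eq_square)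
  finally show ?thesis unfolding L2_set_conv_ip[of f] by (simp add: L2_set_def)
qed

lemma L2_set_slice_diff_le:
  assumes "finite S" "j \<in> S" "k \<in> S"
  shows "L2_set (\<lambda>i. f (j, i) - f (k, i)) {..<d} \<le> 2 * L2_set f (S \<times> {..<d::nat})"
proof -
  have "L2_set (\<lambda>i. f (j, i) - f (k, i)) {..<d} \<le> L2_set (\<lambda>i. f (j, i)) {..<d} + L2_set (\<lambda>i. - f (k, i)) {..<d}"
    using L2_set_triangle_ineq[of "\<lambda>i. f (j, i)" "\<lambda>i. - f (k, i)"] by simp
  also have "L2_set (\<lambda>i. - f (k, i)) {..<d} = L2_set (\<lambda>i. f (k, i)) {..<d}" by (simp add: L2_set_def)
  finally show ?thesis
    using L2_set_slice_le[OF assms(1,2), of f d] L2_set_slice_le[OF assms(1,3), of f d] by linarith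
qed

lemma center_dist_centered:
  "center_dist d x t j k
    = L2_set (\<lambda>i. centered S (\<lambda>k. x k t) (j, i) - centered S (\<lambda>k. x k t) (k, i)) {..<d}"
  by (simp add: center_dist_def centered_def)

text \<open>The sum of squared distances to a point is least for the center of mass.\<close>

lemma centered_norm_le:
  assumes "finite S" "l \<in> S" "\<And>j. j \<in> S \<Longrightarrow> center_dist d x t j l \<le> r"
  shows "L2_set (centered S (\<lambda>k. x k t)) (S \<times> {..<d}) \<le> sqrt (real (card S)) * r"
proof -
  have ne: "S \<noteq> {}" using assms by auto
  have r: "0 \<le> r" using assms(3)[OF assms(2)] L2_set_nonneg unfolding center_dist_def by (rule order_trans[rotated])
  let ?f = "\<lambda>k i. x k t i - x l t i"
  have eq: "centered S (\<lambda>k. x k t) = centered S ?f"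
    using assms(1) ne by (simp add: centered_def fun_eq_iff sum_subtractf diff_divide_distrib)
  have "ip (S \<times> {..<d}) (centered S ?f) (centered S ?f) \<le> (\<Sum>k\<in>S. inner_prod d (?f k) (?f k))"
    unfolding ip_centered[OF assms(1) ne] by (simp add: inner_prod_def sum_nonneg)
  also have "\<dots> \<le> (\<Sum>k\<in>S. r\<^sup>2)"
  proof (rule sum_mono)
    fix k assume "k \<in> S"
    then have "(center_dist d x t k l)\<^sup>2 \<le> r\<^sup>2"
      using assms(3) by (intro power_mono) (auto simp: center_dist_def)
    then show "inner_prod d (?f k) (?f k) \<le> r\<^sup>2" by (simp add: center_dist_square)
  qed
  also have "\<dots> = real (card S) * r\<^sup>2" by simp
  finally have "L2_set (centered S ?f) (S \<times> {..<d}) \<le> sqrt (real (card S) * r\<^sup>2)"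
    unfolding L2_set_conv_ip by simp
  then show ?thesis using r by (simp add: eq real_sqrt_mult)
qed

section \<open>Conservation laws of an isolated family\<close>

context hard_ball_evolution
begin

definition isolated :: "nat set \<Rightarrow> real set \<Rightarrow> bool" where
  "isolated S T \<longleftrightarrow> (\<forall>t\<in>T. \<forall>j\<in>S. \<forall>k. collide n d x t j k \<longrightarrow> k \<in> S)"

abbreviation pos :: "nat set \<Rightarrow> real \<Rightarrow> nat \<times> nat \<Rightarrow> real" where
  "pos S t \<equiv> centered S (\<lambda>k. x k t)"

abbreviation vel :: "nat set \<Rightarrow> real \<Rightarrow> nat \<times> nat \<Rightarrow> real" where
  "vel S t \<equiv> centered S (\<lambda>k. vel_after x k t)"

text \<open>Several disjoint pairs may collide at the same time, so the sum over \<open>S\<close> is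
  doubled and regrouped by collision partners.\<close>

lemma sum_over_colliding_pairs_nonneg:
  assumes S: "S \<subseteq> {..<n}" "isolated S T" "t \<in> T"
    and pair: "\<And>j k. collide n d x t j k \<Longrightarrow> 0 \<le> h j + h k"
    and single: "\<And>k. k < n \<Longrightarrow> vel_after x k t = vel_before x k t \<Longrightarrow> 0 \<le> h k"
  shows "0 \<le> (\<Sum>k\<in>S. h k :: real)"
proof -
  \<comment> \<open>A ball that does not collide at \<open>t\<close> is its own partner, which makes
    \<open>p\<close> an involution of \<open>S\<close>.\<close>
  define p where "p = (\<lambda>k. if \<exists>j. collide n d x t k j then SOME j. collide n d x t k j else k)"
  have p: "p k = j" if "collide n d x t k j" for j k
    using that collision_partner_unique someI[of "\<lambda>j. collide n d x t k j" j] unfolding p_def by auto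
  have p': "p k = k" if "\<nexists>j. collide n d x t k j" for k using that by (auto simp: p_def)
  have pS: "p k \<in> S" if "k \<in> S" for k
    using S that p p' unfolding isolated_def by (cases "\<exists>j. collide n d x t k j") auto
  have pp: "p (p k) = k" for k
    using p p' collide_sym by (cases "\<exists>j. collide n d x t k j") fastforce+
  have "bij_betw p S S"
    by (rule bij_betw_byWitness[where f' = p]) (use pS pp in auto)
  then have "(\<Sum>k\<in>S. h (p k)) = (\<Sum>k\<in>S. h k)" by (rule sum.reindex_bij_betw)
  then have "2 * (\<Sum>k\<in>S. h k) = (\<Sum>k\<in>S. h k + h (p k))" by (simp add: sum.distrib)
  also have "\<dots> \<ge> 0"
  proof (rule sum_nonneg)
    fix k assume "k \<in> S"
    then have kn: "k < n" using S by auto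
    show "0 \<le> h k + h (p k)"
    proof (cases "\<exists>j. collide n d x t k j")
      case True then show ?thesis using p pair by auto
    next
      case False
      then have "vel_after x k t = vel_before x k t"
        using velocity_changes_only_at_collisions[of k t] kn False collide_sym by metis
      then have "0 \<le> h k" using single[OF kn] by blast
      then show ?thesis by (simp add: p'[OF False])
    qed
  qed
  finally show ?thesis by simp
qed

lemma sum_over_colliding_pairs_eq:
  assumes S: "S \<subseteq> {..<n}" "isolated S T" "t \<in> T"
    and pair: "\<And>j k. collide n d x t j k \<Longrightarrow> f j + f k = g j + g k"
    and single: "\<And>k. k < n \<Longrightarrow> vel_after x k t = vel_before x k t \<Longrightarrow> f k = g k"
  shows "(\<Sum>k\<in>S. f k :: real) = (\<Sum>k\<in>S. g k)"
proof -
  have "0 \<le> (\<Sum>k\<in>S. f k - g k)"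
    by (rule sum_over_colliding_pairs_nonneg[OF S]) (use pair single in \<open>force+\<close>)
  moreover have "0 \<le> (\<Sum>k\<in>S. g k - f k)"
    by (rule sum_over_colliding_pairs_nonneg[OF S]) (use pair single in \<open>force+\<close>)
  ultimately show ?thesis by (simp add: sum_subtractf)
qed

text \<open>The impulses are \<open>- \<alpha> * y\<close> and \<open>\<alpha> * y\<close> with
  \<alpha> negative. In the kinetic energy the linear and quadratic terms in them cancel; the virial
  gains \<open>- 4 * \<alpha>\<close>.\<close>

lemma collision_energy:
  assumes c: "collide n d x t j k"
  shows "inner_prod d (vel_after x j t) (vel_after x j t) + inner_prod d (vel_after x k t) (vel_after x k t)
       = inner_prod d (vel_before x j t) (vel_before x j t) + inner_prod d (vel_before x k t) (vel_before x k t)"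
    and "inner_prod d (x j t) (vel_before x j t) + inner_prod d (x k t) (vel_before x k t)
       \<le> inner_prod d (x j t) (vel_after x j t) + inner_prod d (x k t) (vel_after x k t)"
proof -
  define y where "y = (\<lambda>i. x j t i - x k t i)"
  define \<alpha> where "\<alpha> = inner_prod d (\<lambda>i. vel_before x j t i - vel_before x k t i) y / 4"
  note law = collision_law[OF c, folded y_def, folded \<alpha>_def]
  have ve: "vel_after x j t = (\<lambda>i. vel_before x j t i - \<alpha> * y i)"
     "vel_after x k t = (\<lambda>i. vel_before x k t i + \<alpha> * y i)"
    by (simp_all add: law(3,4) fun_eq_iff) (simp_all add: y_def)
  have sq: "inner_prod d (\<lambda>i. f i + c * y i) (\<lambda>i. f i + c * y i)
      = inner_prod d f f + 2 * c * inner_prod d f y + c\<^sup>2 * inner_prod d y y" for f c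
    by (simp add: inner_prod_def algebra_simps sum.distrib sum_distrib_left power2_eq_square)
  have lin: "inner_prod d f (\<lambda>i. g i + c * y i) = inner_prod d f g + c * inner_prod d f y" for f g c
    by (simp add: inner_prod_def algebra_simps sum.distrib sum_distrib_left)
  have a: "inner_prod d (vel_before x j t) y - inner_prod d (vel_before x k t) y = 4 * \<alpha>"
    by (simp add: \<alpha>_def inner_prod_diff_left)
  show "inner_prod d (vel_after x j t) (vel_after x j t) + inner_prod d (vel_after x k t) (vel_after x k t)
       = inner_prod d (vel_before x j t) (vel_before x j t) + inner_prod d (vel_before x k t) (vel_before x k t)"
  proof -
    have "2 * \<alpha> * (inner_prod d (vel_before x j t) y - inner_prod d (vel_before x k t) y) = 8 * \<alpha>\<^sup>2"
      by (simp add: a power2_eq_square)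
    then show ?thesis
      using sq[of "vel_before x j t" "- \<alpha>"] sq[of "vel_before x k t" \<alpha>] law(2)
      by (simp add: ve algebra_simps)
  qed
  have yy: "inner_prod d (x j t) y - inner_prod d (x k t) y = 4"
    using law(2) unfolding y_def by (simp add: inner_prod_diff_left)
  have "\<alpha> * (inner_prod d (x j t) y - inner_prod d (x k t) y) < 0"
    using law(1) by (simp add: yy)
  then show "inner_prod d (x j t) (vel_before x j t) + inner_prod d (x k t) (vel_before x k t)
       \<le> inner_prod d (x j t) (vel_after x j t) + inner_prod d (x k t) (vel_after x k t)"
    using lin[of "x j t" "vel_before x j t" "- \<alpha>"] lin[of "x k t" "vel_before x k t" \<alpha>]
    by (simp add: ve algebra_simps)
qed

lemma
  assumes S: "S \<subseteq> {..<n}" "isolated S T" "t \<in> T"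
  shows momentum_conserved: "(\<Sum>k\<in>S. vel_after x k t i) = (\<Sum>k\<in>S. vel_before x k t i)"
    and energy_conserved: "(\<Sum>k\<in>S. inner_prod d (vel_after x k t) (vel_after x k t))
      = (\<Sum>k\<in>S. inner_prod d (vel_before x k t) (vel_before x k t))"
    and virial_increases: "(\<Sum>k\<in>S. inner_prod d (x k t) (vel_before x k t))
      \<le> (\<Sum>k\<in>S. inner_prod d (x k t) (vel_after x k t))"
proof -
  show "(\<Sum>k\<in>S. vel_after x k t i) = (\<Sum>k\<in>S. vel_before x k t i)"
    by (rule sum_over_colliding_pairs_eq[OF S]) (simp_all add: collision_law(3,4))
  show "(\<Sum>k\<in>S. inner_prod d (vel_after x k t) (vel_after x k t))
      = (\<Sum>k\<in>S. inner_prod d (vel_before x k t) (vel_before x k t))"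
    by (rule sum_over_colliding_pairs_eq[OF S]) (simp_all add: collision_energy(1))
  have "0 \<le> (\<Sum>k\<in>S. inner_prod d (x k t) (vel_after x k t) - inner_prod d (x k t) (vel_before x k t))"
  proof (rule sum_over_colliding_pairs_nonneg[OF S])
    fix j k assume "collide n d x t j k"
    from collision_energy(2)[OF this]
    show "0 \<le> inner_prod d (x j t) (vel_after x j t) - inner_prod d (x j t) (vel_before x j t) +
        (inner_prod d (x k t) (vel_after x k t) - inner_prod d (x k t) (vel_before x k t))" by linarith
  qed simp
  then show "(\<Sum>k\<in>S. inner_prod d (x k t) (vel_before x k t))
      \<le> (\<Sum>k\<in>S. inner_prod d (x k t) (vel_after x k t))" by (simp add: sum_subtractf)
qed

text \<open>Two non-overlapping balls cannot both sit at the center of mass, so the norm is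
  positive. Isolation of collision times provides the short free flights, and the conservation laws
  describe the jump at their ends.\<close>

lemma family_path:
  assumes S: "S \<subseteq> {..<n}" "2 \<le> card S" and T: "is_interval T" and iso: "isolated S T"
  shows "expanding_path (S \<times> {..<d}) T (pos S) (vel S)"
proof
  have fin: "finite S" using S finite_subset by blast
  have ne: "S \<noteq> {}" using S by auto
  show "finite (S \<times> {..<d})" using fin by simp
  show "is_interval T" by fact
  show "0 < L2_set (pos S t) (S \<times> {..<d})" for t
  proof -
    obtain j k where jk: "j \<in> S" "k \<in> S" "j \<noteq> k"
      using S(2) by (metis card_2_iff' card_le_Suc0_iff_eq fin not_less_eq_eq numeral_2_eq_2)
    have "2 \<le> center_dist d x t j k" using no_overlap[of j k t] jk S by auto
    then show ?thesis
      using L2_set_slice_diff_le[OF fin jk(1,2), of "pos S t" d] center_dist_centered[of d x t j k S] by linarith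
  qed
  fix t
  obtain \<delta> where \<delta>: "\<delta> > 0" "\<And>s j k. collide n d x s j k \<Longrightarrow> \<bar>s - t\<bar> < \<delta> \<Longrightarrow> s = t"
    using collision_times_isolated by metis
  have "flight (S \<times> {..<d}) (pos S) (vel S) s u"
    if su: "s \<in> T" "u \<in> T" "s < u" "s = t \<or> u = t" "u - s < \<delta>" for s u
  proof -
    have free: "\<not> collide n d x r j k" if "s < r" "r < u" for r j k
      using \<delta>(2)[of r j k] that su by (auto simp: abs_less_iff)
    have kn: "k < n" if "k \<in> S" for k using S that by auto
    have x: "x k u i = x k s i + (u - s) * vel_after x k s i" if "k \<in> S" for k i
      using free_flight(1)[OF kn[OF that] su(3), of u i] free su by auto
    have v: "vel_before x k u = vel_after x k s" if "k \<in> S" for k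
      using free_flight(2)[OF kn[OF that] su(3)] free by (auto simp: fun_eq_iff)
    have 1: "pos S u p = pos S s p + (u - s) * vel S s p" if "p \<in> S \<times> {..<d}" for p
      using that by (auto simp: centered_def x sum.distrib sum_subtractf sum_distrib_left[symmetric] algebra_simps add_divide_distrib diff_divide_distrib)
    have mom: "(\<lambda>i. \<Sum>k\<in>S. vel_after x k u i) = (\<lambda>i. \<Sum>k\<in>S. vel_after x k s i)"
      using momentum_conserved[OF S(1) iso su(2)] v by (simp add: fun_eq_iff)
    have en: "(\<Sum>k\<in>S. inner_prod d (vel_after x k u) (vel_after x k u))
      = (\<Sum>k\<in>S. inner_prod d (vel_after x k s) (vel_after x k s))"
      using energy_conserved[OF S(1) iso su(2)] v by simp
    have vi: "(\<Sum>k\<in>S. inner_prod d (x k u) (vel_after x k s))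
      \<le> (\<Sum>k\<in>S. inner_prod d (x k u) (vel_after x k u))"
      using virial_increases[OF S(1) iso su(2)] v by simp
    show ?thesis
      unfolding flight_def ip_centered[OF fin ne] using 1 mom en vi su(3) by simp
  qed
  then show "\<exists>\<delta>>0. \<forall>s\<in>T. \<forall>u\<in>T. s < u \<and> (s = t \<or> u = t) \<and> u - s < \<delta> \<longrightarrow>
        flight (S \<times> {..<d}) (pos S) (vel S) s u"
    using \<delta>(1) by (intro exI[of _ \<delta>]) auto
qed

end

section \<open>Counting collisions\<close>

lemma center_dist_triangle: "center_dist d x t j k \<le> center_dist d x t j l + center_dist d x t l k"
  using L2_set_triangle_ineq[of "\<lambda>i. x j t i - x l t i" "\<lambda>i. x l t i - x k t i" "{..<d}"]
  by (simp add: center_dist_def)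

text \<open>The distance of two balls changes by at most twice the displacement in configuration
  space, whence the later step sizes \<open>\<rho> / 4\<close> and
  \<open>1 / (8 * \<mu>)\<close>.\<close>

lemma L2_set_pair_distance_le:
  assumes "finite S" "j \<in> S" "k \<in> S"
  shows "L2_set (\<lambda>i. f (j, i) - f (k, i)) {..<d} - L2_set (\<lambda>i. g (j, i) - g (k, i)) {..<d}
     \<le> 2 * L2_set (\<lambda>p. f p - g p) (S \<times> {..<d::nat})"
proof -
  have "L2_set (\<lambda>i. f (j, i) - f (k, i)) {..<d} - L2_set (\<lambda>i. g (j, i) - g (k, i)) {..<d}
      \<le> L2_set (\<lambda>i. (f (j, i) - f (k, i)) - (g (j, i) - g (k, i))) {..<d}"
    by (rule L2_set_triangle_ineq_diff)
  also have "\<dots> = L2_set (\<lambda>i. (f (j, i) - g (j, i)) - (f (k, i) - g (k, i))) {..<d}"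
    by (rule L2_set_cong) auto
  also have "\<dots> \<le> 2 * L2_set (\<lambda>p. f p - g p) (S \<times> {..<d})"
    by (rule L2_set_slice_diff_le[OF assms])
  finally show ?thesis .
qed

text \<open>Pigeonhole: the first \<open>card S\<close> windows of length \<open>q\<close> above 0
  cannot all contain a value, since \<open>f j0\<close> lies beyond them. An empty window is the
  gap.\<close>

lemma finite_family_gap:
  assumes fin: "finite S" and l: "l \<in> S" and q: "0 < (q::real)"
    and far: "j0 \<in> S" "real (card S) * q < f j0" and l0: "f l \<le> 0"
  obtains S' i where "S' \<subset> S" "S' \<noteq> {}" "\<And>j. j \<in> S' \<Longrightarrow> f j \<le> i" "\<And>k. k \<in> S - S' \<Longrightarrow> i + q < f k"
proof -
  have "\<exists>i<card S. \<nexists>j. j \<in> S \<and> real i * q < f j \<and> f j \<le> (real i + 1) * q"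
  proof (rule ccontr)
    assume "\<not> ?thesis"
    then obtain g where g: "\<And>i. i < card S \<Longrightarrow> g i \<in> S \<and> real i * q < f (g i) \<and> f (g i) \<le> (real i + 1) * q"
      by metis
    have lt: "f (g i) < f (g i')" if "i < i'" "i' < card S" for i i'
    proof -
      have "(real i + 1) * q \<le> real i' * q" using that q by (intro mult_right_mono) auto
      then show ?thesis using g[of i] g[of i'] that by linarith
    qed
    have "inj_on g {..<card S}"
      by (rule linorder_inj_onI') (use lt in fastforce)
    moreover have "g ` {..<card S} \<subseteq> S - {j0}"
    proof (rule image_subsetI)
      fix i assume "i \<in> {..<card S}"
      moreover from this have "(real i + 1) * q \<le> real (card S) * q"
        using q by (intro mult_right_mono) auto
      ultimately show "g i \<in> S - {j0}" using g[of i] far by auto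
    qed
    ultimately have "card {..<card S} \<le> card (S - {j0})"
      using fin by (intro card_inj_on_le) auto
    then show False using far fin card_gt_0_iff[of S] by (auto simp: card_Diff_singleton)
  qed
  then obtain i where i: "i < card S" "\<And>j. j \<in> S \<Longrightarrow> real i * q < f j \<Longrightarrow> (real i + 1) * q < f j"
    by (meson not_le)
  show thesis
  proof (rule that[of "{j \<in> S. f j \<le> real i * q}" "real i * q"])
    have "real i * q \<le> real (card S) * q" using i q by (intro mult_right_mono) auto
    then have "j0 \<notin> {j \<in> S. f j \<le> real i * q}" using far by auto
    then show "{j \<in> S. f j \<le> real i * q} \<subset> S" using far by blast
    have "f l \<le> real i * q" using l0 q by (meson mult_nonneg_nonneg of_nat_0_le_iff order_trans less_imp_le)
    then show "{j \<in> S. f j \<le> real i * q} \<noteq> {}" using l by auto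
  qed (use i(2) in \<open>auto simp: algebra_simps not_le\<close>)
qed

section \<open>Bounding collision counts by coverings\<close>

lemma num_collisions_le_sum:
  assumes "finite I" "collisions n d x B T \<subseteq> (\<Union>i\<in>I. collisions n d x (B' i) (T' i))"
  shows "num_collisions n d x B T \<le> (\<Sum>i\<in>I. num_collisions n d x (B' i) (T' i))"
proof -
  have "num_collisions n d x B T \<le> emeasure (count_space UNIV) (\<Union>i\<in>I. collisions n d x (B' i) (T' i))"
    unfolding num_collisions_def by (rule emeasure_mono) (use assms in auto)
  also have "\<dots> \<le> (\<Sum>i\<in>I. num_collisions n d x (B' i) (T' i))"
    unfolding num_collisions_def by (rule emeasure_subadditive_finite) (use assms in auto)
  finally show ?thesis .
qed

lemma num_collisions_le_card_mult:
  assumes "finite I" "collisions n d x B T \<subseteq> (\<Union>i\<in>I. collisions n d x (B' i) (T' i))"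
    and "\<And>i. i \<in> I \<Longrightarrow> num_collisions n d x (B' i) (T' i) \<le> K"
  shows "num_collisions n d x B T \<le> ennreal (real (card I)) * K"
proof -
  have "num_collisions n d x B T \<le> (\<Sum>i\<in>I. num_collisions n d x (B' i) (T' i))"
    by (rule num_collisions_le_sum[OF assms(1,2)])
  also have "\<dots> \<le> (\<Sum>i\<in>I. K)" by (rule sum_mono) (rule assms(3))
  finally show ?thesis by (simp add: ennreal_of_nat_eq_real_of_nat)
qed

lemma emeasure_count_space_le:
  assumes "\<And>F. finite F \<Longrightarrow> F \<subseteq> X \<Longrightarrow> of_nat (card F) \<le> K"
  shows "emeasure (count_space UNIV) X \<le> K"
proof (cases "finite X")
  case True then show ?thesis using assms[of X] by simp
next
  case False
  have "of_nat m \<le> K" for m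
    using infinite_arbitrarily_large[OF False, of m] assms by metis
  then have "K = \<infinity>" by (metis ennreal_Ex_less_of_nat infinity_ennreal_def not_le top.not_eq_extremum)
  then show ?thesis by simp
qed

text \<open>Finitely many collisions lie between the first and the last of their times, both in
  \<open>T\<close>. Bounds on closed intervals thus reach sets \<open>T\<close> of unknown
  shape.\<close>

lemma num_collisions_compact_exhaustion:
  assumes "\<And>s u. s \<in> T \<Longrightarrow> u \<in> T \<Longrightarrow> s \<le> u \<Longrightarrow> num_collisions n d x B {s..u} \<le> K"
  shows "num_collisions n d x B T \<le> K"
  unfolding num_collisions_def
proof (rule emeasure_count_space_le)
  fix F assume F: "finite F" "F \<subseteq> collisions n d x B T"
  show "of_nat (card F) \<le> K"
  proof (cases "F = {}")
    case False
    define s u where "s = Min (snd ` F)" and "u = Max (snd ` F)"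
    have "snd ` F \<subseteq> T" using F by (auto simp: collisions_def)
    moreover have "s \<in> snd ` F" "u \<in> snd ` F" unfolding s_def u_def
      using F False by (simp_all add: Min_in Max_in)
    moreover have b: "s \<le> snd p" "snd p \<le> u" if "p \<in> F" for p
      using that F by (auto simp: s_def u_def)
    moreover have "F \<subseteq> collisions n d x B {s..u}"
    proof
      fix p assume "p \<in> F"
      with F have "p \<in> collisions n d x B T" by blast
      then show "p \<in> collisions n d x B {s..u}"
        using b[OF \<open>p \<in> F\<close>] unfolding collisions_def by fastforce
    qed
    then have "emeasure (count_space UNIV) F \<le> num_collisions n d x B {s..u}"
      unfolding num_collisions_def by (intro emeasure_mono) auto
    moreover have "s \<le> u" using b False by (meson ex_in_conv order_trans)
    ultimately have "emeasure (count_space UNIV) F \<le> K"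
      using assms[of s u] by (meson order_trans subsetD)
    then show ?thesis using F by simp
  qed simp
qed

text \<open>\<open>f\<close> will be the time or the angle. The half-open slices numbered 0 to the
  floor of \<open>len / c\<close> cover its range, the last one catching the end value
  \<open>\<alpha> + len\<close>; this accounts for the added 1.\<close>

lemma num_collisions_slices:
  assumes f: "\<And>t. t \<in> T \<Longrightarrow> \<alpha> \<le> f t \<and> f t \<le> \<alpha> + len" and c: "0 < (c::real)" and len: "0 \<le> len"
    and slice: "\<And>b. num_collisions n d x B {t \<in> T. b \<le> f t \<and> f t < b + c} \<le> K"
  shows "num_collisions n d x B T \<le> ennreal (len / c + 1) * K"
proof -
  define m where "m = nat \<lfloor>len / c\<rfloor>"
  have "num_collisions n d x B T \<le> ennreal (real (card {..m})) * K"
  proof (rule num_collisions_le_card_mult)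
    show "collisions n d x B T \<subseteq> (\<Union>i\<in>{..m}. collisions n d x B
        {t \<in> T. \<alpha> + real i * c \<le> f t \<and> f t < (\<alpha> + real i * c) + c})"
    proof
      fix p assume "p \<in> collisions n d x B T"
      then obtain j k t where p: "p = ({j, k}, t)" "j \<in> B" "k \<in> B" "t \<in> T" "collide n d x t j k"
        by (auto simp: collisions_def)
      define i where "i = nat \<lfloor>(f t - \<alpha>) / c\<rfloor>"
      have ft: "0 \<le> (f t - \<alpha>) / c" "(f t - \<alpha>) / c \<le> len / c"
        using f[OF p(4)] c by (auto intro!: divide_nonneg_pos divide_right_mono)
      have "i \<le> m" unfolding i_def m_def using ft by (intro nat_mono floor_mono)
      have "real i \<le> (f t - \<alpha>) / c" "(f t - \<alpha>) / c < real i + 1"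
        unfolding i_def using ft by (auto simp: of_nat_nat)
      then have "\<alpha> + real i * c \<le> f t" "f t < (\<alpha> + real i * c) + c"
        using c by (simp_all add: field_simps)
      then show "p \<in> (\<Union>i\<in>{..m}. collisions n d x B
          {t \<in> T. \<alpha> + real i * c \<le> f t \<and> f t < (\<alpha> + real i * c) + c})"
        using p \<open>i \<le> m\<close> unfolding collisions_def by blast
    qed
  qed (use slice in auto)
  also have "\<dots> \<le> ennreal (len / c + 1) * K"
  proof (rule mult_right_mono[OF ennreal_leI])
    have "0 \<le> len / c" using c len by simp
    then have "real m \<le> len / c" unfolding m_def by (simp add: of_nat_nat)
    then show "real (card {..m}) \<le> len / c + 1" by simp
  qed simp
  finally show ?thesis .
qed

section \<open>The recursion on the size of the family\<close>

context hard_ball_evolution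
begin

text \<open>By \<open>centered_norm_le\<close> some ball is farther than \<open>card S * q\<close>
  from a fixed ball \<open>l\<close>. A gap of length \<open>q\<close> among the distances to
  \<open>l\<close> separates the two parts, by the triangle inequality.\<close>

lemma family_gap:
  assumes S: "S \<subseteq> {..<n}" "S \<noteq> {}" and q: "0 < q"
    and far: "sqrt (real (card S)) * (real (card S) * q) < L2_set (pos S t) (S \<times> {..<d})"
  obtains S' where "S' \<subset> S" "S' \<noteq> {}" "\<And>j k. j \<in> S' \<Longrightarrow> k \<in> S - S' \<Longrightarrow> q < center_dist d x t j k"
proof -
  have fin: "finite S" using S finite_subset by blast
  obtain l where l: "l \<in> S" using S by auto
  obtain j0 where j0: "j0 \<in> S" "real (card S) * q < center_dist d x t j0 l"
    using centered_norm_le[OF fin l, of d x t "real (card S) * q"] far by fastforce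
  have "center_dist d x t l l \<le> 0" by (simp add: center_dist_def L2_set_def)
  from finite_family_gap[OF fin l q j0(1), of "\<lambda>j. center_dist d x t j l", OF j0(2) this]
  obtain S' i where S': "S' \<subset> S" "S' \<noteq> {}" "\<And>j. j \<in> S' \<Longrightarrow> center_dist d x t j l \<le> i"
    "\<And>k. k \<in> S - S' \<Longrightarrow> i + q < center_dist d x t k l" by blast
  show thesis
  proof (rule that[OF S'(1,2)])
    fix j k assume "j \<in> S'" "k \<in> S - S'"
    then show "q < center_dist d x t j k"
      using S'(3)[of j] S'(4)[of k] center_dist_triangle[of d x t k l j] center_dist_commute[of d x t]
      by fastforce
  qed
qed

text \<open>The threshold \<open>2 + \<rho> / 2\<close> at time \<open>s\<close> leaves room for the
  change \<open>\<rho> / 2\<close>: its edges remain edges of the graph for \<rho> throughout, so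
  its components are \<rho>-connected. Conversely, a pair colliding later is already joined at
  \<open>s\<close>. Components are indexed by their members, hence the factor
  \<open>card S\<close>.\<close>

lemma slow_piece_bound:
  assumes S: "S \<subseteq> {..<n}" and su: "s \<le> u"
    and M: "\<And>B s u. B \<subseteq> {..<n} \<Longrightarrow> s \<le> u \<Longrightarrow> rho_connected n d x \<rho> B s u \<Longrightarrow> num_collisions n d x B {s..u} \<le> M"
    and slow: "\<And>r j k. r \<in> {s..u} \<Longrightarrow> j \<in> S \<Longrightarrow> k \<in> S \<Longrightarrow> \<bar>center_dist d x r j k - center_dist d x s j k\<bar> \<le> \<rho> / 2"
  shows "num_collisions n d x S {s..u} \<le> ennreal (real (card S)) * M"
proof -
  define Q where "Q = {(j, k). j \<in> S \<and> k \<in> S \<and> j \<noteq> k \<and> center_dist d x s j k \<le> 2 + \<rho> / 2}"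
  define comp where "comp = (\<lambda>j. {k \<in> S. (j, k) \<in> Q\<^sup>*})"
  have "sym Q" by (auto simp: Q_def sym_def center_dist_commute)
  then have symQ: "sym (Q\<^sup>*)" by (rule sym_rtrancl)
  have near: "Q\<^sup>* \<subseteq> (near n d x \<rho> r)\<^sup>*" if "r \<in> {s..u}" for r
  proof (rule rtrancl_mono, safe)
    fix j k assume jk: "(j, k) \<in> Q"
    then have "\<bar>center_dist d x r j k - center_dist d x s j k\<bar> \<le> \<rho> / 2"
      using slow[OF that] by (auto simp: Q_def)
    then have "center_dist d x r j k \<le> 2 + \<rho>"
      using jk by (auto simp only: Q_def mem_Collect_eq prod.case abs_le_iff)
    then show "(j, k) \<in> near n d x \<rho> r"
      using jk S by (auto simp: Q_def near_def)
  qed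
  have conn: "rho_connected n d x \<rho> (comp j) s u" for j
    unfolding rho_connected_def
  proof (intro ballI subsetI)
    fix r p assume r: "r \<in> {s..u}" and p: "p \<in> comp j \<times> comp j"
    then have "p \<in> Q\<^sup>*" unfolding comp_def
      using symQ by (auto simp: sym_def intro: rtrancl_trans)
    then show "p \<in> (near n d x \<rho> r)\<^sup>*" using near[OF r] by blast
  qed
  show ?thesis
  proof (rule num_collisions_le_card_mult[where B' = comp and T' = "\<lambda>_. {s..u}"])
    show "finite S" using S finite_subset by blast
    show "num_collisions n d x (comp j) {s..u} \<le> M" for j
      by (rule M[OF _ su conn]) (use S in \<open>auto simp: comp_def\<close>)
    show "collisions n d x S {s..u} \<subseteq> (\<Union>j\<in>S. collisions n d x (comp j) {s..u})"
    proof
      fix p assume "p \<in> collisions n d x S {s..u}"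
      then obtain j k t where p: "p = ({j, k}, t)" "j \<in> S" "k \<in> S" "t \<in> {s..u}" "collide n d x t j k"
        by (auto simp: collisions_def)
      have "center_dist d x s j k \<le> 2 + \<rho> / 2"
        using slow[OF p(4,2,3)] p(5) unfolding collide_def by linarith
      then have "(j, k) \<in> Q" using p by (auto simp: Q_def collide_def)
      then have "j \<in> comp j" "k \<in> comp j" using p by (auto simp: comp_def)
      then show "p \<in> (\<Union>j\<in>S. collisions n d x (comp j) {s..u})"
        using p unfolding collisions_def by blast
    qed
  qed
qed

lemma split_bound:
  assumes S': "S' \<subset> S" "S' \<noteq> {}" "finite S" and iso: "isolated S T"
    and apart: "\<And>r j k. r \<in> T \<Longrightarrow> j \<in> S' \<Longrightarrow> k \<in> S - S' \<Longrightarrow> 2 < center_dist d x r j k"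
    and IH: "\<And>B. B \<subset> S \<Longrightarrow> isolated B T \<Longrightarrow> num_collisions n d x B T \<le> K"
  shows "num_collisions n d x S T \<le> 2 * K"
proof -
  have no: "\<not> collide n d x r j k" "\<not> collide n d x r k j" if "r \<in> T" "j \<in> S'" "k \<in> S - S'" for r j k
    using apart[OF that] by (auto simp: collide_def center_dist_commute)
  have iso': "isolated S' T" "isolated (S - S') T"
    using iso no S'(1) unfolding isolated_def by blast+
  have "collisions n d x S T \<subseteq> (\<Union>b\<in>UNIV. collisions n d x (if b then S' else S - S') T)"
  proof
    fix p assume "p \<in> collisions n d x S T"
    then obtain j k t where p: "p = ({j, k}, t)" "j \<in> S" "k \<in> S" "t \<in> T" "collide n d x t j k"
      by (auto simp: collisions_def)
    then have "j \<in> S' \<longleftrightarrow> k \<in> S'" using no by blast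
    then show "p \<in> (\<Union>b\<in>UNIV. collisions n d x (if b then S' else S - S') T)"
      using p unfolding collisions_def by (auto simp: UNIV_bool)
  qed
  then have "num_collisions n d x S T \<le> ennreal (real (card (UNIV :: bool set))) * K"
    by (rule num_collisions_le_card_mult[rotated]) (use IH iso' S' in auto)
  then show ?thesis by simp
qed

text \<open>Zero energy would give all balls of the family the same velocity after the collision,
  against \<open>separating\<close>. The time and angle estimates need this positivity.\<close>

lemma energy_pos_at_collision:
  assumes "finite S" "collide n d x t j k" "j \<in> S" "k \<in> S"
  shows "0 < ip (S \<times> {..<d}) (vel S t) (vel S t)"
proof (rule ccontr)
  assume "\<not> ?thesis"
  then have "ip (S \<times> {..<d}) (vel S t) (vel S t) = 0"
    using ip_self_nonneg[of "S \<times> {..<d}" "vel S t"] by simp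
  then have z: "vel S t p = 0" if "p \<in> S \<times> {..<d}" for p
    using that assms(1) unfolding ip_def by (subst (asm) sum_nonneg_eq_0_iff) auto
  have "vel_after x j t i - vel_after x k t i = 0" if "i < d" for i
    using z[of "(j, i)"] z[of "(k, i)"] assms that by (simp add: centered_def)
  then have "inner_prod d (\<lambda>i. vel_after x j t i - vel_after x k t i) (\<lambda>i. x j t i - x k t i) = 0"
    by (simp add: inner_prod_def)
  then show False using separating[OF assms(2)] by simp
qed

text \<open>
  Rescaled to the unit sphere, the gap between the two parts at the time of smallest \<open>R\<close> exceeds
  the distance that the configuration can turn, so the parts stay apart.
\<close>

lemma split_when_spread:
  fixes S T
  defines "\<mu> \<equiv> real (card S) * sqrt (real (card S))"
  defines "R \<equiv> \<lambda>t. L2_set (pos S t) (S \<times> {..<d})"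
  assumes S: "S \<subseteq> {..<n}" "S \<noteq> {}" and R0: "4 * \<mu> < R s0"
    and least: "\<And>r. r \<in> T \<Longrightarrow> R s0 \<le> R r"
    and turn: "\<And>r. r \<in> T \<Longrightarrow>
      L2_set (\<lambda>p. pos S s0 p / R s0 - pos S r p / R r) (S \<times> {..<d}) \<le> 1 / (8 * \<mu>)"
  obtains S' where "S' \<subset> S" "S' \<noteq> {}"
    "\<And>r j k. r \<in> T \<Longrightarrow> j \<in> S' \<Longrightarrow> k \<in> S - S' \<Longrightarrow> 2 < center_dist d x r j k"
proof -
  have fin: "finite S" using S finite_subset by blast
  then have \<mu>: "0 < \<mu>" using S by (simp add: \<mu>_def card_gt_0_iff)
  have R0': "0 < R s0" using R0 \<mu> by linarith
  \<comment> \<open>The factor 3/4 gives the strict inequality that \<open>family_gap\<close> asks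
    for. Divided by \<open>R s0\<close> the gap is \<open>3 / (4 * \<mu>)\<close>; turning takes at
    most \<open>1 / (4 * \<mu>)\<close> of it, and the remaining \<open>1 / (2 * \<mu>)\<close>
    times a radius above \<open>4 * \<mu>\<close> exceeds 2.\<close>
  define q where "q = 3 / 4 * (R s0 / \<mu>)"
  have q: "0 < q" using \<mu> R0' by (simp add: q_def)
  have "sqrt (real (card S)) * (real (card S) * q) = \<mu> * q" by (simp add: \<mu>_def)
  also have "\<mu> * q < R s0" using \<mu> R0' by (simp add: q_def)
  finally obtain S' where S': "S' \<subset> S" "S' \<noteq> {}" "\<And>j k. j \<in> S' \<Longrightarrow> k \<in> S - S' \<Longrightarrow> q < center_dist d x s0 j k"
    unfolding R_def using family_gap[OF S q] by metis
  show thesis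
  proof (rule that[OF S'(1,2)])
    fix r j k assume r: "r \<in> T" and jk: "j \<in> S'" "k \<in> S - S'"
    have jkS: "j \<in> S" "k \<in> S" using S' jk by auto
    have Rr: "R s0 \<le> R r" by (rule least[OF r])
    have scaled: "L2_set (\<lambda>i. pos S t (j, i) / c - pos S t (k, i) / c) {..<d} = center_dist d x t j k / c"
      if "0 < c" for t c
    proof -
      have "L2_set (\<lambda>i. pos S t (j, i) / c - pos S t (k, i) / c) {..<d}
        = L2_set (\<lambda>i. inverse c * (pos S t (j, i) - pos S t (k, i))) {..<d}"
        by (rule L2_set_cong) (auto simp: divide_inverse algebra_simps)
      also have "\<dots> = inverse c * L2_set (\<lambda>i. pos S t (j, i) - pos S t (k, i)) {..<d}"
        using that by (intro L2_set_right_distrib[symmetric]) simp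
      finally show ?thesis by (simp add: center_dist_centered[of d x t j k S] field_simps)
    qed
    define \<gamma> where "\<gamma> = 1 / \<mu>"
    have "center_dist d x s0 j k / R s0 - center_dist d x r j k / R r \<le> 2 * (1 / (8 * \<mu>))"
      using L2_set_pair_distance_le[OF fin jkS, of "\<lambda>p. pos S s0 p / R s0" d "\<lambda>p. pos S r p / R r"]
        turn[OF r] scaled[of "R s0" s0] scaled[of "R r" r] R0' Rr by simp
    also have "2 * (1 / (8 * \<mu>)) = \<gamma> / 4" by (simp add: \<gamma>_def)
    finally have "center_dist d x s0 j k / R s0 - center_dist d x r j k / R r \<le> \<gamma> / 4" .
    moreover have "3 * \<gamma> / 4 = q / R s0" using R0' by (simp add: q_def \<gamma>_def)
    moreover have "q / R s0 < center_dist d x s0 j k / R s0"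
      using S'(3)[OF jk] R0' by (simp add: divide_strict_right_mono)
    ultimately have "\<gamma> / 2 < center_dist d x r j k / R r" by linarith
    then have "\<gamma> / 2 * R r < center_dist d x r j k"
      using R0' Rr by (simp only: pos_less_divide_eq)
    moreover have "\<gamma> / 2 * R s0 \<le> \<gamma> / 2 * R r" using \<mu> Rr by (intro mult_left_mono) (auto simp: \<gamma>_def)
    moreover have "2 < \<gamma> / 2 * R s0" using R0 \<mu> by (simp add: \<gamma>_def field_simps)
    ultimately show "2 < center_dist d x r j k" by linarith
  qed
qed

text \<open>Compact times are sliced by time and charged to \<rho>-connected families, spread times
  are sliced by angle and charged to two smaller families. The given collision ensures at least two
  balls and positive energy.\<close>

lemma collisions_le_recursion:
  assumes \<rho>: "0 < \<rho>" "\<rho> \<le> 1"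
    and M: "\<And>B s u. B \<subseteq> {..<n} \<Longrightarrow> s \<le> u \<Longrightarrow> rho_connected n d x \<rho> B s u \<Longrightarrow> num_collisions n d x B {s..u} \<le> M"
    and S: "S \<subseteq> {..<n}" and T: "is_interval T" and iso: "isolated S T"
    and IH: "\<And>B s u. B \<subset> S \<Longrightarrow> isolated B {s..u} \<Longrightarrow> num_collisions n d x B {s..u} \<le> K"
    and c0: "collide n d x t0 j0 k0" "t0 \<in> T" "j0 \<in> S" "k0 \<in> S"
  defines "a \<equiv> real n * sqrt (real n)"
  shows "num_collisions n d x S T \<le> ennreal (65 * a / \<rho>) * (ennreal (real n) * M) + ennreal (66 * a) * (2 * K)"
proof -
  have fin: "finite S" using S finite_subset by blast
  have "card {j0, k0} \<le> card S" using c0 fin by (intro card_mono) auto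
  then have c2: "2 \<le> card S" using c0 by (auto simp: collide_def)
  then have ne: "S \<noteq> {}" by auto
  have cardn: "card S \<le> n" using S card_mono[of "{..<n}" S] by simp
  interpret P: expanding_path "S \<times> {..<d}" T "pos S" "vel S"
    by (rule family_path[OF S c2 T iso])
  define E where "E = P.E t0"
  define V where "V = sqrt E"
  have E0: "0 < E" unfolding E_def by (rule energy_pos_at_collision[OF fin c0(1,3,4)])
  have E: "P.E t = E" if "t \<in> T" for t using P.energy_constant[OF c0(2) that] by (simp add: E_def)
  have V: "0 < V" using E0 by (simp add: V_def)
  define \<mu> where "\<mu> = real (card S) * sqrt (real (card S))"
  have \<mu>1: "1 \<le> \<mu>" unfolding \<mu>_def using c2 mult_mono[of 1 "real (card S)" 1 "sqrt (real (card S))"] by simp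
  have \<mu>a: "\<mu> \<le> a" unfolding \<mu>_def a_def using cardn by (intro mult_mono) auto
  have inT: "r \<in> T" if "s \<in> T" "u \<in> T" "r \<in> {s..u}" for r s u
    using mem_is_interval_1_I[OF T that(1,2)] that(3) by auto
  have isosub: "isolated S {s..u}" if "s \<in> T" "u \<in> T" for s u
    using iso inT[OF that] unfolding isolated_def by blast
  define T1 where "T1 = {t \<in> T. P.R t \<le> 4 * \<mu>}"
  \<comment> \<open>Spread times are divided by the sign of \<open>P.A\<close>, so that on an
    interval between two times of \<open>T2\<close> or of \<open>T3\<close> the least radius is at
    an end.\<close>
  define T2 where "T2 = {t \<in> T. 4 * \<mu> < P.R t \<and> 0 \<le> P.A t}"
  define T3 where "T3 = {t \<in> T. 4 * \<mu> < P.R t \<and> P.A t < 0}"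

  have N1: "num_collisions n d x S T1 \<le> ennreal (65 * a / \<rho>) * (ennreal (real n) * M)"
  proof (cases "T1 = {}")
    case True then show ?thesis by (simp add: num_collisions_def collisions_def)
  next
    case False
    then obtain \<tau> where \<tau>: "\<tau> \<in> T1" by auto
    have near: "\<bar>t - \<tau>\<bar> \<le> 8 * \<mu> / V" if "t \<in> T1" for t
    proof (cases t \<tau> rule: linorder_cases)
      case less
      then show ?thesis using P.compact_time_le[of t \<tau> "4 * \<mu>"] that \<tau> E0
        by (simp add: T1_def E V_def abs_if)
    next
      case greater
      then show ?thesis using P.compact_time_le[of \<tau> t "4 * \<mu>"] that \<tau> E0
        by (simp add: T1_def E V_def abs_if)
    qed (use \<mu>1 V in auto)
    \<comment> \<open>\<open>T1\<close> lies within \<open>8 * \<mu> / V\<close> of \<tau> on either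
      side. During a slice of length \<open>\<rho> / (4 * V)\<close> the configuration moves by at
      most \<open>\<rho> / 4\<close>, so pair distances change by at most
      \<open>\<rho> / 2\<close>.\<close>
    have "num_collisions n d x S T1 \<le> ennreal ((16 * \<mu> / V) / (\<rho> / (4 * V)) + 1) * (ennreal (real n) * M)"
    proof (rule num_collisions_slices[where f = "\<lambda>t. t" and \<alpha> = "\<tau> - 8 * \<mu> / V"])
      fix b
      show "num_collisions n d x S {t \<in> T1. b \<le> t \<and> t < b + \<rho> / (4 * V)} \<le> ennreal (real n) * M"
      proof (rule num_collisions_compact_exhaustion)
        fix s u assume su: "s \<in> {t \<in> T1. b \<le> t \<and> t < b + \<rho> / (4 * V)}"
          "u \<in> {t \<in> T1. b \<le> t \<and> t < b + \<rho> / (4 * V)}" "s \<le> u"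
        then have suT: "s \<in> T" "u \<in> T" by (auto simp: T1_def)
        have "num_collisions n d x S {s..u} \<le> ennreal (real (card S)) * M"
        proof (rule slow_piece_bound[OF S su(3) M])
          fix r j k assume r: "r \<in> {s..u}" and jk: "j \<in> S" "k \<in> S"
          have rT: "r \<in> T" by (rule inT[OF suT r])
          have "r - s \<le> \<rho> / (4 * V)" using r su by auto
          then have "V * (r - s) \<le> \<rho> / 4" using V by (simp add: field_simps)
          moreover have "L2_set (\<lambda>p. pos S r p - pos S s p) (S \<times> {..<d}) \<le> V * (r - s)"
          proof (cases "r = s")
            case False
            then show ?thesis using P.displacement_le[OF suT(1) rT] r E[OF suT(1)] by (simp add: V_def)
          qed (simp add: L2_set_def)
          ultimately have disp: "L2_set (\<lambda>p. pos S r p - pos S s p) (S \<times> {..<d}) \<le> \<rho> / 4" by linarith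
          then have disp': "L2_set (\<lambda>p. pos S s p - pos S r p) (S \<times> {..<d}) \<le> \<rho> / 4"
            by (simp only: L2_set_minus_commute[of "pos S s"])
          show "\<bar>center_dist d x r j k - center_dist d x s j k\<bar> \<le> \<rho> / 2"
            using L2_set_pair_distance_le[OF fin jk, of "pos S r" d "pos S s"]
              L2_set_pair_distance_le[OF fin jk, of "pos S s" d "pos S r"] disp disp'
            unfolding center_dist_centered[of d x _ j k S] by linarith
        qed
        also have "\<dots> \<le> ennreal (real n) * M"
          using cardn by (intro mult_right_mono ennreal_leI) auto
        finally show "num_collisions n d x S {s..u} \<le> ennreal (real n) * M" .
      qed
    qed (use near V \<rho> \<mu>1 in \<open>auto simp: abs_le_iff algebra_simps\<close>)
    also have "(16 * \<mu> / V) / (\<rho> / (4 * V)) + 1 = 64 * \<mu> / \<rho> + 1" using V by simp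
    also have "ennreal (64 * \<mu> / \<rho> + 1) * (ennreal (real n) * M) \<le> ennreal (65 * a / \<rho>) * (ennreal (real n) * M)"
    proof (intro mult_right_mono ennreal_leI)
      have "1 \<le> \<mu> / \<rho>" using \<rho> \<mu>1 by (simp add: field_simps)
      moreover have "\<mu> / \<rho> \<le> a / \<rho>" using \<mu>a \<rho> by (simp add: divide_right_mono)
      ultimately show "64 * \<mu> / \<rho> + 1 \<le> 65 * a / \<rho>" by simp
    qed simp
    finally show ?thesis .
  qed

  have far: "num_collisions n d x S U \<le> ennreal (33 * a) * (2 * K)"
    if U: "U \<subseteq> T" "\<And>s u. s \<in> U \<Longrightarrow> u \<in> U \<Longrightarrow> s \<le> u \<Longrightarrow> \<exists>s0\<in>{s..u}. 4 * \<mu> < P.R s0 \<and> (\<forall>r\<in>{s..u}. P.R s0 \<le> P.R r)"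
    for U
  proof -
    have "num_collisions n d x S U \<le> ennreal (pi / (1 / (8 * \<mu>)) + 1) * (2 * K)"
    proof (rule num_collisions_slices[where f = P.\<theta> and \<alpha> = 0])
      fix b
      show "num_collisions n d x S {t \<in> U. b \<le> P.\<theta> t \<and> P.\<theta> t < b + 1 / (8 * \<mu>)} \<le> 2 * K"
      proof (rule num_collisions_compact_exhaustion)
        fix s u assume su: "s \<in> {t \<in> U. b \<le> P.\<theta> t \<and> P.\<theta> t < b + 1 / (8 * \<mu>)}"
          "u \<in> {t \<in> U. b \<le> P.\<theta> t \<and> P.\<theta> t < b + 1 / (8 * \<mu>)}" "s \<le> u"
        then have suT: "s \<in> T" "u \<in> T" using U(1) by auto
        obtain s0 where s0: "s0 \<in> {s..u}" "4 * \<mu> < P.R s0" "\<And>r. r \<in> {s..u} \<Longrightarrow> P.R s0 \<le> P.R r"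
          using U(2)[of s u] su by blast
        have turn: "L2_set (\<lambda>p. pos S r' p / P.R r' - pos S r p / P.R r) (S \<times> {..<d}) \<le> P.\<theta> r - P.\<theta> r'"
          if "r \<in> T" "r' \<in> T" "r \<le> r'" for r r'
        proof (cases "r = r'")
          case False
          then show ?thesis using P.turning_le[OF that(1,2)] that E[OF that(1)] E0 by simp
        qed (simp add: L2_set_def)
        have \<theta>mono: "P.\<theta> r' \<le> P.\<theta> r" if "r \<in> T" "r' \<in> T" "r \<le> r'" for r r'
          using turn[OF that] L2_set_nonneg[of "\<lambda>p. pos S r' p / P.R r' - pos S r p / P.R r" "S \<times> {..<d}"] by linarith
        \<comment> \<open>The angle is monotone and its values at \<open>s\<close> and
          \<open>u\<close> share a slice, so it varies by less than the slice width on
          \<open>{s..u}\<close>, whichever of \<open>r\<close> and \<open>s0\<close> comes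
          first.\<close>
        have turn0: "L2_set (\<lambda>p. pos S s0 p / P.R s0 - pos S r p / P.R r) (S \<times> {..<d}) \<le> 1 / (8 * \<mu>)"
          if r: "r \<in> {s..u}" for r
        proof -
          have rT: "r \<in> T" "s0 \<in> T" using inT[OF suT] r s0(1) by auto
          have rng: "P.\<theta> u \<le> P.\<theta> q \<and> P.\<theta> q \<le> P.\<theta> s" if "q \<in> {s..u}" for q
            using \<theta>mono[OF suT(1) inT[OF suT that]] \<theta>mono[OF inT[OF suT that] suT(2)] that by auto
          have lim: "\<bar>P.\<theta> r - P.\<theta> s0\<bar> \<le> 1 / (8 * \<mu>)"
            using rng[OF r] rng[OF s0(1)] su(1,2) by auto
          show ?thesis
          proof (cases "r \<le> s0")
            case True then show ?thesis using turn[OF rT True] lim by linarith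
          next
            case False
            then show ?thesis
              using turn[OF rT(2,1)] lim by (subst L2_set_minus_commute) linarith
          qed
        qed
        from split_when_spread[OF S ne, where T = "{s..u}" and ?s0.0 = s0, folded \<mu>_def, OF s0(2,3) turn0]
        obtain S' where S': "S' \<subset> S" "S' \<noteq> {}"
          "\<And>r j k. r \<in> {s..u} \<Longrightarrow> j \<in> S' \<Longrightarrow> k \<in> S - S' \<Longrightarrow> 2 < center_dist d x r j k" by blast
        show "num_collisions n d x S {s..u} \<le> 2 * K"
          by (rule split_bound[OF S'(1,2) fin isosub[OF suT] S'(3) IH])
      qed
    qed (use P.\<theta>_bounds \<mu>1 in auto)
    also have "pi / (1 / (8 * \<mu>)) + 1 = 8 * \<mu> * pi + 1" by simp
    \<comment> \<open>The 33 is \<open>8 * 4 + 1\<close>, with \<open>pi\<close> bounded by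
      4.\<close>
    also have "ennreal (8 * \<mu> * pi + 1) * (2 * K) \<le> ennreal (33 * a) * (2 * K)"
    proof (intro mult_right_mono ennreal_leI)
      have "8 * \<mu> * pi \<le> 8 * \<mu> * 4" using pi_less_4 \<mu>1 by (intro mult_left_mono) auto
      then show "8 * \<mu> * pi + 1 \<le> 33 * a" using \<mu>1 \<mu>a by linarith
    qed simp
    finally show ?thesis .
  qed

  have N2: "num_collisions n d x S T2 \<le> ennreal (33 * a) * (2 * K)"
  proof (rule far)
    fix s u assume "s \<in> T2" "u \<in> T2" "s \<le> u"
    then have s: "s \<in> T" "u \<in> T" "s \<le> u" "4 * \<mu> < P.R s" "0 \<le> P.A s" by (auto simp: T2_def)
    have "P.R s \<le> P.R r" if "r \<in> {s..u}" for r
      using P.R_mono_forward(1)[OF s(1) inT[OF s(1,2) that] _ s(5)] that by simp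
    then show "\<exists>s0\<in>{s..u}. 4 * \<mu> < P.R s0 \<and> (\<forall>r\<in>{s..u}. P.R s0 \<le> P.R r)"
      using s(3,4) by (intro bexI[of _ s]) auto
  qed (auto simp: T2_def)
  have N3: "num_collisions n d x S T3 \<le> ennreal (33 * a) * (2 * K)"
  proof (rule far)
    fix s u assume "s \<in> T3" "u \<in> T3" "s \<le> u"
    then have s: "s \<in> T" "u \<in> T" "s \<le> u" "4 * \<mu> < P.R u" "P.A u < 0" by (auto simp: T3_def)
    have "P.R u \<le> P.R r" if "r \<in> {s..u}" for r
      using P.R_mono_backward(1)[OF inT[OF s(1,2) that] s(2) _ s(5)] that by simp
    then show "\<exists>s0\<in>{s..u}. 4 * \<mu> < P.R s0 \<and> (\<forall>r\<in>{s..u}. P.R s0 \<le> P.R r)"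
      using s(3,4) by (intro bexI[of _ u]) auto
  qed (auto simp: T3_def)
  define TT where "TT = (\<lambda>i::nat. if i = 0 then T1 else if i = 1 then T2 else T3)"
  have "num_collisions n d x S T \<le> (\<Sum>i\<in>{0,1,2}. num_collisions n d x S (TT i))"
  proof (rule num_collisions_le_sum)
    show "collisions n d x S T \<subseteq> (\<Union>i\<in>{0,1,2}. collisions n d x S (TT i))"
    proof
      fix p assume "p \<in> collisions n d x S T"
      then obtain j k t where p: "p = ({j, k}, t)" "j \<in> S" "k \<in> S" "t \<in> T" "collide n d x t j k"
        by (auto simp: collisions_def)
      have "t \<in> T1 \<or> t \<in> T2 \<or> t \<in> T3" using p(4) unfolding T1_def T2_def T3_def mem_Collect_eq by linarith
      then have "\<exists>i\<in>{0,1,2}. t \<in> TT i" by (auto simp: TT_def)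
      then show "p \<in> (\<Union>i\<in>{0,1,2}. collisions n d x S (TT i))"
        using p unfolding collisions_def by blast
    qed
  qed simp
  also have "\<dots> = num_collisions n d x S T1 + (num_collisions n d x S T2 + num_collisions n d x S T3)"
    by (simp add: TT_def)
  also have "\<dots> \<le> ennreal (65 * a / \<rho>) * (ennreal (real n) * M) + (ennreal (33 * a) * (2 * K) + ennreal (33 * a) * (2 * K))"
    by (intro add_mono N1 N2 N3)
  also have "ennreal (33 * a) * (2 * K) + ennreal (33 * a) * (2 * K) = ennreal (66 * a) * (2 * K)"
  proof -
    have "ennreal (66 * a) = ennreal (33 * a) + ennreal (33 * a)"
      using \<mu>1 \<mu>a by (subst ennreal_plus[symmetric]) auto
    then show ?thesis by (simp add: distrib_right)
  qed
  finally show ?thesis .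
qed

text \<open>Induction on a bound \<open>m\<close> for the family size. \<open>T\<close> varies in
  the induction because the parts of a spread family are isolated only during the piece on which
  they stay apart.\<close>

lemma collisions_le:
  assumes \<rho>: "0 < \<rho>" "\<rho> \<le> 1"
    and M: "\<And>B s u. B \<subseteq> {..<n} \<Longrightarrow> s \<le> u \<Longrightarrow> rho_connected n d x \<rho> B s u \<Longrightarrow> num_collisions n d x B {s..u} \<le> M"
  shows "S \<subseteq> {..<n} \<Longrightarrow> card S \<le> m \<Longrightarrow> is_interval T \<Longrightarrow> isolated S T \<Longrightarrow>
    num_collisions n d x S T \<le> ennreal (real n / \<rho> * (200 * (real n * sqrt (real n))) ^ m) * M"
proof (induction m arbitrary: S T)
  case 0
  then have "S = {}" using finite_subset[of S "{..<n}"] by auto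
  then show ?case by (simp add: num_collisions_def collisions_def)
next
  case (Suc m)
  define a where "a = real n * sqrt (real n)"
  define F where "F = real n / \<rho> * (200 * a) ^ m"
  have fin: "finite S" using Suc.prems finite_subset by blast
  show ?case
  proof (cases "collisions n d x S T = {}")
    case True then show ?thesis by (simp add: num_collisions_def)
  next
    case False
    then obtain j k t where c: "collide n d x t j k" "t \<in> T" "j \<in> S" "k \<in> S"
      by (auto simp: collisions_def)
    then have n: "1 \<le> n" by (auto simp: collide_def)
    then have a: "1 \<le> a" unfolding a_def using mult_mono[of 1 "real n" 1 "sqrt (real n)"] by simp
    have "1 \<le> (200 * a) ^ m" using a by (intro one_le_power) simp
    then have F: "real n / \<rho> \<le> F" unfolding F_def using \<rho> mult_left_mono[of 1 "(200 * a) ^ m" "real n / \<rho>"] by simp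
    have nr: "0 < real n / \<rho>" using \<rho> n by simp
    have "num_collisions n d x S T
        \<le> ennreal (65 * a / \<rho>) * (ennreal (real n) * M) + ennreal (66 * a) * (2 * (ennreal F * M))"
      unfolding a_def
    proof (rule collisions_le_recursion[OF \<rho> M Suc.prems(1,3,4) _ c])
      fix B s u assume B: "B \<subset> S" "isolated B {s..u}"
      have "card B < card S" using fin B by (intro psubset_card_mono)
      then show "num_collisions n d x B {s..u} \<le> ennreal F * M"
        unfolding F_def a_def using Suc.IH[of B "{s..u}"] B Suc.prems by (auto simp: is_interval_cc)
    qed
    also have "ennreal (66 * a) * (2 * (ennreal F * M)) = ennreal (132 * a * F) * M"
    proof -
      have "ennreal (66 * a) * ennreal 2 * ennreal F = ennreal (132 * a * F)"
        using a F nr by (simp only: ennreal_mult[symmetric]) (simp add: ennreal_mult[symmetric])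
      then show ?thesis by (simp add: mult.assoc[symmetric])
    qed
    also have "ennreal (65 * a / \<rho>) * (ennreal (real n) * M) = ennreal (65 * a * (real n / \<rho>)) * M"
      using a \<rho> by (simp add: mult.assoc[symmetric] ennreal_mult[symmetric])
    also have "ennreal (65 * a * (real n / \<rho>)) * M + ennreal (132 * a * F) * M
        = ennreal (65 * a * (real n / \<rho>) + 132 * a * F) * M"
      using a F nr \<rho> by (subst ennreal_plus) (simp_all add: distrib_right)
    \<comment> \<open>The two contributions add up to at most \<open>197 * a * F\<close>, which 200
      covers.\<close>
    also have "\<dots> \<le> ennreal (real n / \<rho> * (200 * a) ^ Suc m) * M"
    proof (intro mult_right_mono ennreal_leI)
      have "65 * a * (real n / \<rho>) \<le> 65 * a * F" using F a by (intro mult_left_mono) auto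
      moreover have "0 \<le> a * F" using F nr a by simp
      ultimately have "65 * a * (real n / \<rho>) + 132 * a * F \<le> 200 * a * F" by (simp add: algebra_simps)
      then show "65 * a * (real n / \<rho>) + 132 * a * F \<le> real n / \<rho> * (200 * a) ^ Suc m"
        by (simp add: F_def mult_ac)
    qed simp
    finally show ?thesis by (simp add: a_def)
  qed
qed

end

section \<open>Choice of \<eta> and the final comparison\<close>

theorem theorem1p3:
  shows "\<exists>\<eta> :: nat \<Rightarrow> real. \<eta> \<longlonglongrightarrow> 0 \<and>
    (\<forall>\<epsilon>::real. \<epsilon> > 0 \<longrightarrow> (\<exists>n\<^sub>0::nat. \<forall>n\<ge>n\<^sub>0. \<forall>d\<ge>2. \<forall>(\<rho>::real) (N::real) x.
       0 < \<rho> \<longrightarrow> \<rho> \<le> real n powr (- real n) \<longrightarrow> N > 1 \<longrightarrow>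
       ln (N * \<rho>) > (3 / 2 + \<epsilon>) * real n * ln (real n) \<longrightarrow>
       hard_ball_evolution n d x \<longrightarrow>
       num_collisions n d x {..<n} UNIV \<ge> ennreal N \<longrightarrow>
       (\<exists>B t\<^sub>1 t\<^sub>2. B \<subseteq> {..<n} \<and> t\<^sub>1 \<le> t\<^sub>2 \<and>
          rho_connected n d x \<rho> B t\<^sub>1 t\<^sub>2 \<and>
          num_collisions n d x B {t\<^sub>1..t\<^sub>2}
            > ennreal (N * \<rho> * real n powr (- ((3 / 2 + \<eta> n) * real n))))))"
proof -
  define \<eta> :: "nat \<Rightarrow> real" where "\<eta> = (\<lambda>n. 1 / real n + 6 / ln (real n))"
    \<comment> \<open>\<open>n powr (\<eta> n * n) = n * exp 6 ^ n\<close> absorbs the factor \<open>n * 200 ^ n\<close> of \<open>collisions_le\<close>\<close>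
  have "filterlim (\<lambda>n. ln (real n)) at_infinity sequentially"
    by (intro filterlim_at_top_imp_at_infinity filterlim_compose[OF ln_at_top filterlim_real_sequentially])
  then have "(\<lambda>n. 6 / ln (real n)) \<longlonglongrightarrow> 0" by (intro tendsto_divide_0[OF tendsto_const])
  from tendsto_add[OF lim_const_over_n[of 1] this] have "\<eta> \<longlonglongrightarrow> 0" by (simp add: \<eta>_def)
  moreover have "\<exists>B t\<^sub>1 t\<^sub>2. B \<subseteq> {..<n} \<and> t\<^sub>1 \<le> t\<^sub>2 \<and> rho_connected n d x \<rho> B t\<^sub>1 t\<^sub>2 \<and>
          num_collisions n d x B {t\<^sub>1..t\<^sub>2} > ennreal (N * \<rho> * real n powr (- ((3 / 2 + \<eta> n) * real n)))"
    if n: "2 \<le> n" and \<rho>: "0 < \<rho>" "\<rho> \<le> real n powr - real n" and N: "1 < N"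
    and ev: "hard_ball_evolution n d x" and many: "ennreal N \<le> num_collisions n d x {..<n} UNIV"
    for n d :: nat and \<rho> N :: real and x
  proof (rule ccontr)
    interpret hard_ball_evolution n d x by (fact ev)
    define M where "M = N * \<rho> * real n powr (- ((3 / 2 + \<eta> n) * real n))"
    have "real n powr - real n \<le> real n powr 0" using n by (intro powr_mono) auto
    then have \<rho>1: "\<rho> \<le> 1" using \<rho> n by simp
    assume "\<not> ?thesis"
    \<comment> \<open>If every \<rho>-connected family had at most \<open>M\<close> collisions,
      \<open>collisions_le\<close> for all balls and all times would bound the total below
      \<open>N\<close>.\<close>
    then have no: "num_collisions n d x B {s..u} \<le> ennreal M"
      if "B \<subseteq> {..<n}" "s \<le> u" "rho_connected n d x \<rho> B s u" for B s u
      using that unfolding M_def by (meson not_le)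
    have "isolated {..<n} UNIV" by (auto simp: isolated_def collide_def)
    then have "num_collisions n d x {..<n} UNIV
        \<le> ennreal (real n / \<rho> * (200 * (real n * sqrt (real n))) ^ n) * ennreal M"
      by (intro collisions_le[OF \<rho>(1) \<rho>1 no]) auto
    from order_trans[OF many this]
    have "ennreal N \<le> ennreal (real n / \<rho> * (200 * (real n * sqrt (real n))) ^ n * M)"
      using \<rho> N by (subst ennreal_mult) (auto simp: M_def)
    then have le: "N \<le> real n / \<rho> * (200 * (real n * sqrt (real n))) ^ n * M"
      using \<rho> N by (subst (asm) ennreal_le_iff) (auto simp: M_def)
    have lnpos: "0 < ln (real n)" using n by simp
    have "real n * sqrt (real n) = real n powr (3 / 2)"
      using n powr_add[of "real n" 1 "1/2"] by (simp add: powr_half_sqrt)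
    then have pw: "(real n * sqrt (real n)) ^ n = real n powr (3 / 2 * real n)"
      using n by (simp add: powr_powr powr_realpow[symmetric])
    have ex: "real n powr (\<eta> n * real n) = real n * exp 6 ^ n"
    proof -
      have "\<eta> n * real n * ln (real n) = ln (real n) + real n * 6"
        using n lnpos by (simp add: \<eta>_def field_simps)
      moreover have "real n powr (\<eta> n * real n) = exp (\<eta> n * real n * ln (real n))"
        using n by (simp add: powr_def)
      ultimately have "real n powr (\<eta> n * real n) = exp (ln (real n) + real n * 6)" by simp
      then show ?thesis using n by (simp only: exp_add exp_of_nat_mult) simp
    qed
    have "real n powr (- ((3 / 2 + \<eta> n) * real n)) * real n powr (3 / 2 * real n) * real n powr (\<eta> n * real n) = 1"
      using n by (simp add: powr_add[symmetric] algebra_simps)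
    then have cancel: "real n powr (- ((3 / 2 + \<eta> n) * real n)) * real n powr (3 / 2 * real n) * (real n * exp 6 ^ n) = 1"
      by (simp only: ex)
    \<comment> \<open>\<open>Y\<close> collects the powers of \<open>n\<close> left after inserting
      \<open>M\<close>; by the choice of \<eta> it is the reciprocal of
      \<open>exp 6 ^ n\<close>.\<close>
    define Y where "Y = real n powr (- ((3 / 2 + \<eta> n) * real n)) * real n powr (3 / 2 * real n) * real n"
    have Y: "0 < Y" "Y * exp 6 ^ n = 1" using n cancel by (simp_all add: Y_def mult_ac)
    have "real n / \<rho> * (200 * (real n * sqrt (real n))) ^ n * M = N * (Y * 200 ^ n)"
      unfolding power_mult_distrib[of 200] pw M_def Y_def using \<rho> by (simp add: field_simps)
    also have "\<dots> < N * (Y * exp 6 ^ n)"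
    proof -
      \<comment> \<open>The quadratic Taylor bound gives \<open>exp 1\<close> at least 5/2, whose
        sixth power exceeds 244.\<close>
      have "(5/2::real) ^ 6 \<le> exp 1 ^ 6"
        using exp_lower_Taylor_quadratic[of 1] by (intro power_mono) auto
      also have "exp 1 ^ 6 = exp (6::real)" using exp_of_nat_mult[of 6 "1::real"] by simp
      finally have "(200::real) < exp 6" by (simp add: power_divide)
      then have "(200::real) ^ n < exp 6 ^ n" using n by (intro power_strict_mono) auto
      then have "Y * 200 ^ n < Y * exp 6 ^ n" using Y(1) by (rule mult_strict_left_mono)
      then show ?thesis using N by simp
    qed
    finally show False using le Y by simp
  qed
  \<comment> \<open>The threshold 2 makes \<open>ln (real n)\<close>, a denominator in \<eta>,
    positive.\<close>
  ultimately show ?thesis by (intro exI[of _ \<eta>] conjI allI impI exI[of _ "2::nat"]) blast+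
qed

end
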